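(* Let $(X,d)$ be a compact metric space, $f:X\to X$ a continuous map with the specification property, and $\varphi\in C(X)$. Write $S_n\varphi(x)=\sum_{i=0}^{n-1}\varphi(f^i(x))$. The following are equivalent: (a) $\widehat X_\varphi$ is non-empty; (b) $\frac1nS_n\varphi$ does not converge pointwise to a constant; (c) $\inf_{\mu\in\mathcal{M}_f(X)}\int\varphi\,d\mu<\sup_{\mu\in\mathcal{M}_f(X)}\int\varphi\,d\mu$; (d) $\inf_{\mu\in\mathcal{M}^e_f(X)}\int\varphi\,d\mu<\sup_{\mu\in\mathcal{M}^e_f(X)}\int\varphi\,d\mu$; (e) $\varphi\notin\bigcup_{c\in\mathbb{R}}\overline{Cob(X,f,c)}$; (f) $\frac1nS_n\varphi$ does not converge uniformly to a constant.
   Context: $C(X)$ is the space of continuous functions $X\to\mathbb{R}$; $\mathcal{M}_f(X)$ is the set of $f$-invariant Borel probability measures on $X$ and $\mathcal{M}_f^e(X)$ the subset of ergodic ones. The irregular set is $\widehat X_\varphi=\{x\in X:\lim_{n\to\infty}\frac1nS_n\varphi(x)\text{ does not exist}\}$. For a constant $c$, $Cob(X,f,c)$ is the set of functions in $C(X)$ cohomologous to $c$, i.e. of the form $c+h-h\circ f$ with $h\in C(X)$; $\overline{Cob(X,f,c)}$ is its closure in the sup norm. Specification property: a continuous map $f:X\to X$ has the specification property if for all $\epsilon>0$ there is an integer $m=m(\epsilon)$ such that for any finite collection of finite integer intervals $I_j=[a_j,b_j]\subset\mathbb{N}$, $j=1,\dots,k$, with $a_{j+1}-b_j\ge m(\epsilon)$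 for $j=1,\dots,k-1$, and any $x_1,\dots,x_k\in X$, there is a point $x\in X$ with $d(f^{p+a_j}x,f^px_j)<\epsilon$ for all $p=0,\dots,b_j-a_j$ and every $j=1,\dots,k$. *)

theory Defs
  imports "HOL-Probability.Probability"
begin

text \<open>
  The space \<open>X\<close> is the universe of a metric type. When it is compact, every continuous real
  function on it is bounded, so \<open>'a \<Rightarrow>\<^sub>C real\<close> is \<open>C(X)\<close> and its norm is the sup norm.
\<close>

definition birkhoff_sum :: "('a \<Rightarrow> 'a) \<Rightarrow> ('a \<Rightarrow> real) \<Rightarrow> nat \<Rightarrow> 'a \<Rightarrow> real" where
  "birkhoff_sum f \<phi> n x = (\<Sum>i<n. \<phi> ((f ^^ i) x))"

definition birkhoff_average :: "('a \<Rightarrow> 'a) \<Rightarrow> ('a \<Rightarrow> real) \<Rightarrow> nat \<Rightarrow> 'a \<Rightarrow> real" where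
  "birkhoff_average f \<phi> n x = (1 / real n) * birkhoff_sum f \<phi> n x"

definition irregular_set :: "('a \<Rightarrow> 'a) \<Rightarrow> ('a \<Rightarrow> real) \<Rightarrow> 'a set" where
  "irregular_set f \<phi> = {x. \<not> convergent (\<lambda>n. birkhoff_average f \<phi> n x)}"

definition invariant_measures :: "('a::topological_space \<Rightarrow> 'a) \<Rightarrow> 'a measure set" where
  "invariant_measures f = {\<mu>. prob_space \<mu> \<and> sets \<mu> = sets borel \<and> distr \<mu> borel f = \<mu>}"

definition ergodic_measures :: "('a::topological_space \<Rightarrow> 'a) \<Rightarrow> 'a measure set" where
  "ergodic_measures f =
    {\<mu> \<in> invariant_measures f.
      \<forall>A \<in> sets borel. f -` A = A \<longrightarrow> measure \<mu> A = 0 \<or> measure \<mu> A = 1}"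

definition cob :: "('a::topological_space \<Rightarrow> 'a) \<Rightarrow> real \<Rightarrow> ('a \<Rightarrow>\<^sub>C real) set" where
  "cob f c = {g :: 'a \<Rightarrow>\<^sub>C real. \<exists>h :: 'a \<Rightarrow>\<^sub>C real. \<forall>x. g x = c + h x - h (f x)}"

definition specification_property :: "('a::metric_space \<Rightarrow> 'a) \<Rightarrow> bool" where
  "specification_property f \<longleftrightarrow>
    (\<forall>\<epsilon>>0. \<exists>m::int. \<forall>(k::nat) (a :: nat \<Rightarrow> nat) (b :: nat \<Rightarrow> nat) (xs :: nat \<Rightarrow> 'a).
      (\<forall>j\<in>{1..k}. a j \<le> b j) \<and>
      (\<forall>j\<in>{1..<k}. int (a (j + 1)) - int (b j) \<ge> m) \<longrightarrow>
      (\<exists>x. \<forall>j\<in>{1..k}. \<forall>p\<in>{0..b j - a j}. dist ((f ^^ (p + a j)) x) ((f ^^ p) (xs j)) < \<epsilon>))"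

end

theory Submission
  imports Defs
begin

text \<open>
  Let \<open>p(g)\<close> be the infimum over \<open>n \<ge> 1\<close> of the maximum over \<open>X\<close> of the \<open>n\<close>-th Birkhoff average
  of \<open>g\<close>. It is sublinear, it is nonpositive on the functions \<open>h \<circ> f - h\<close>, and it bounds the
  integral of \<open>g\<close> against every invariant measure. Hence linear functionals dominated by \<open>p\<close> are
  represented by invariant measures (Riesz), and extreme such functionals by ergodic ones. A
  Hahn-Banach argument along faces produces an extreme functional with prescribed value \<open>p(\<phi>)\<close>
  at \<open>\<phi>\<close>. So the ergodic integrals of \<open>\<phi>\<close> attain \<open>p(\<phi>)\<close> and \<open>- p(- \<phi>)\<close>; if these numbers agree,
  the Birkhoff averages converge uniformly to their common value \<open>c\<close>, which is equivalent to
  \<open>\<phi>\<close> being in the closure of the functions cohomologous to \<open>c\<close>, since \<open>\<phi>\<close> is cohomologous to each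
  of its Birkhoff averages. Only the existence of an irregular point uses specification: an orbit
  that shadows alternately two orbits with different limits has oscillating averages.
\<close>

subsection \<open>Extreme dominated functionals\<close>

text \<open>Ergodicity is reached through extremality: an invariant set of measure strictly between
  0 and 1 splits an invariant measure into its two normalised restrictions, which are again
  invariant and hence dominated by \<open>p\<close>. Faces are represented by their support
  functions instead of sets of functionals. Passing to a smaller face then means passing to a
  smaller sublinear function, infima along chains stay inside the class, and a minimal member is
  odd, hence linear. Working with functionals dominated by \<open>p\<close> makes the prescribed
  value at \<open>\<phi>\<close> an algebraic matter; measures enter only once the functional is
  chosen. The two orbits to be shadowed come from an argument by contradiction: if no point is
  irregular, every point has a limit, and unless all limits agree two points with different limits
  are at hand.\<close>

definition sublinear :: "('v::real_vector \<Rightarrow> real) \<Rightarrow> bool" where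
  "sublinear p \<longleftrightarrow> (\<forall>u v. p (u + v) \<le> p u + p v) \<and> (\<forall>t>0. \<forall>v. p (t *\<^sub>R v) \<le> t * p v) \<and> p 0 = 0"

lemma sublinearD:
  assumes "sublinear p"
  shows "p (u + v) \<le> p u + p v" "t > 0 \<Longrightarrow> p (t *\<^sub>R v) \<le> t * p v" "p 0 = 0"
  using assms unfolding sublinear_def by auto

lemma sublinear_neg_le: "sublinear p \<Longrightarrow> - p (- v) \<le> p v"
  using sublinearD(1)[of p v "- v"] sublinearD(3)[of p] by simp

text \<open>The inequality in the definition is what survives taking infima; using it once more with
  \<open>1 / t\<close> gives the reverse.\<close>

lemma sublinear_scale:
  assumes p: "sublinear p" and t: "0 \<le> t"
  shows "p (t *\<^sub>R v) = t * p v"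
proof (cases "t = 0")
  case False
  with t have t: "t > 0" by simp
  have "p v \<le> (1 / t) * p (t *\<^sub>R v)"
    using sublinearD(2)[OF p, of "1 / t" "t *\<^sub>R v"] t by simp
  then have "t * p v \<le> p (t *\<^sub>R v)"
    using t by (simp add: field_simps)
  with sublinearD(2)[OF p t, of v] show ?thesis by simp
qed (use sublinearD(3)[OF p] in simp)

text \<open>Oddness turns subadditivity at \<open>- u\<close> and \<open>- v\<close> into
  superadditivity at \<open>u\<close> and \<open>v\<close>.\<close>

lemma sublinear_odd_imp_linear:
  assumes "sublinear p" "\<And>v. p (- v) = - p v"
  shows "linear p"
proof (rule linearI)
  fix u v
  have "p (- u + - v) \<le> p (- u) + p (- v)"
    by (rule sublinearD(1)[OF assms(1)])
  then have "- p (u + v) \<le> - p u - p v"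
    using assms(2)[of "u + v"] assms(2)[of u] assms(2)[of v] by simp
  with sublinearD(1)[OF assms(1), of u v] show "p (u + v) = p u + p v" by simp
next
  fix t v
  show "p (t *\<^sub>R v) = t *\<^sub>R p v"
  proof (cases "0 \<le> t")
    case True
    then show ?thesis using sublinear_scale[OF assms(1)] by simp
  next
    case False
    then have "p ((- t) *\<^sub>R v) = - t * p v"
      using sublinear_scale[OF assms(1), of "- t" v] by simp
    then show ?thesis using assms(2)[of "t *\<^sub>R v"] by simp
  qed
qed

text \<open>The support function of the face of the functionals dominated by \<open>q\<close> that maximise \<open>v0\<close>.\<close>

definition face_support :: "('v::real_vector \<Rightarrow> real) \<Rightarrow> 'v \<Rightarrow> 'v \<Rightarrow> real" where
  "face_support q v0 v = (INF t\<in>{0..}. q (v + t *\<^sub>R v0) - t * q v0)"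

text \<open>Subadditivity supplies a lower bound independent of \<open>t\<close>, so that the
  infimum in \<open>face_support\<close> is a genuine one.\<close>

lemma face_support_bdd:
  assumes q: "sublinear q"
  shows "bdd_below ((\<lambda>t. q (v + t *\<^sub>R v0) - t * q v0) ` {0..})"
proof (rule bdd_belowI2)
  fix t :: real assume "t \<in> {0..}"
  then have t: "0 \<le> t" by simp
  have "q ((v + t *\<^sub>R v0) + - v) \<le> q (v + t *\<^sub>R v0) + q (- v)"
    by (rule sublinearD(1)[OF q])
  then show "- q (- v) \<le> q (v + t *\<^sub>R v0) - t * q v0"
    using sublinear_scale[OF q t, of v0] by simp
qed

lemma face_support_le:
  assumes "sublinear q" "0 \<le> t"
  shows "face_support q v0 v \<le> q (v + t *\<^sub>R v0) - t * q v0"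
  unfolding face_support_def using assms by (intro cINF_lower face_support_bdd) auto

lemma face_support_greatest:
  assumes "\<And>t. 0 \<le> t \<Longrightarrow> c \<le> q (v + t *\<^sub>R v0) - t * q v0"
  shows "c \<le> face_support q v0 v"
  unfolding face_support_def using assms by (intro cINF_greatest) auto

lemma face_support_below: "sublinear q \<Longrightarrow> face_support q v0 v \<le> q v"
  using face_support_le[of q 0 v0 v] by simp

text \<open>The choice \<open>t = 1\<close> cancels \<open>v0\<close>. A linear \<open>l\<close>
  below \<open>face_support q v0\<close> thus satisfies \<open>l v0 \<ge> q v0\<close>: the bound at
  \<open>- v0\<close> is what expresses that the face consists of maximisers.\<close>

lemma face_support_neg: "sublinear q \<Longrightarrow> face_support q v0 (- v0) \<le> - q v0"
  using face_support_le[of q 1 v0 "- v0"] by (simp add: sublinearD(3))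

text \<open>Parameters \<open>s\<close> for \<open>u\<close> and \<open>t\<close> for
  \<open>v\<close> merge into \<open>s + t\<close> for \<open>u + v\<close>, because the subtracted
  term is linear in the parameter. The two infima are then taken one after the other.\<close>

lemma sublinear_face_support:
  assumes q: "sublinear q"
  shows "sublinear (face_support q v0)"
  unfolding sublinear_def
proof (intro conjI allI impI)
  fix u v
  have "face_support q v0 (u + v) - (q (u + s *\<^sub>R v0) - s * q v0) \<le> face_support q v0 v"
    if s: "0 \<le> s" for s
  proof (rule face_support_greatest)
    fix t :: real assume t: "0 \<le> t"
    have "face_support q v0 (u + v) \<le> q ((u + v) + (s + t) *\<^sub>R v0) - (s + t) * q v0"
      using s t by (intro face_support_le[OF q]) simp
    also have "(u + v) + (s + t) *\<^sub>R v0 = (u + s *\<^sub>R v0) + (v + t *\<^sub>R v0)"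
      by (simp add: algebra_simps)
    also have "q \<dots> \<le> q (u + s *\<^sub>R v0) + q (v + t *\<^sub>R v0)"
      by (rule sublinearD(1)[OF q])
    finally show "face_support q v0 (u + v) - (q (u + s *\<^sub>R v0) - s * q v0)
        \<le> q (v + t *\<^sub>R v0) - t * q v0"
      by (simp add: algebra_simps)
  qed
  then have "face_support q v0 (u + v) - face_support q v0 v \<le> face_support q v0 u"
    by (intro face_support_greatest) (simp add: algebra_simps)
  then show "face_support q v0 (u + v) \<le> face_support q v0 u + face_support q v0 v"
    by simp
next
  fix t v assume t: "(0::real) < t"
  have "face_support q v0 (t *\<^sub>R v) / t \<le> face_support q v0 v"
  proof (rule face_support_greatest)
    fix s :: real assume s: "0 \<le> s"
    have "face_support q v0 (t *\<^sub>R v) \<le> q (t *\<^sub>R v + (t * s) *\<^sub>R v0) - (t * s) * q v0"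
      using s t by (intro face_support_le[OF q]) simp
    also have "t *\<^sub>R v + (t * s) *\<^sub>R v0 = t *\<^sub>R (v + s *\<^sub>R v0)"
      by (simp add: algebra_simps)
    also have "q \<dots> = t * q (v + s *\<^sub>R v0)"
      using sublinear_scale[OF q] t by simp
    finally show "face_support q v0 (t *\<^sub>R v) / t \<le> q (v + s *\<^sub>R v0) - s * q v0"
      using t by (simp add: field_simps)
  qed
  then show "face_support q v0 (t *\<^sub>R v) \<le> t * face_support q v0 v"
    using t by (simp add: field_simps)
next
  have "face_support q v0 0 \<le> 0"
    using face_support_below[OF q, of v0 0] sublinearD(3)[OF q] by simp
  moreover have "0 \<le> face_support q v0 0"
    using sublinear_scale[OF q] by (intro face_support_greatest) simp
  ultimately show "face_support q v0 0 = 0" by simp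
qed

text \<open>The linear functionals dominated by \<open>q\<close> form a face of the convex set of those dominated by \<open>p\<close>.\<close>

definition face_functional :: "('v::real_vector \<Rightarrow> real) \<Rightarrow> ('v \<Rightarrow> real) \<Rightarrow> bool" where
  "face_functional p q \<longleftrightarrow> sublinear q \<and> q \<le> p \<and>
    (\<forall>l1 l2 t. linear l1 \<and> linear l2 \<and> l1 \<le> p \<and> l2 \<le> p \<and> 0 < t \<and> t < 1 \<and>
      (\<forall>v. t * l1 v + (1 - t) * l2 v \<le> q v) \<longrightarrow> l1 \<le> q)"

lemma face_functionalD:
  assumes "face_functional p q"
  shows "sublinear q" "q \<le> p"
    "\<lbrakk>linear l1; linear l2; l1 \<le> p; l2 \<le> p; 0 < t; t < 1;
      \<And>v. t * l1 v + (1 - t) * l2 v \<le> q v\<rbrakk> \<Longrightarrow> l1 \<le> q"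
  using assms unfolding face_functional_def by blast+

text \<open>A face of a face is a face. Both functionals first land below \<open>q\<close>; their
  values at \<open>v0\<close> are then at most \<open>q v0\<close> with weighted mean at least
  \<open>q v0\<close>, which forces \<open>l1 v0 = q v0\<close>.\<close>

lemma face_functional_face_support:
  assumes q: "face_functional p q"
  shows "face_functional p (face_support q v0)"
  unfolding face_functional_def
proof (intro conjI allI impI)
  note sq = face_functionalD(1)[OF q]
  show "sublinear (face_support q v0)" by (rule sublinear_face_support[OF sq])
  show "face_support q v0 \<le> p"
    using order_trans[OF face_support_below[OF sq] le_funD[OF face_functionalD(2)[OF q]]]
    by (rule le_funI)
  fix l1 l2 :: "'a \<Rightarrow> real" and t :: real
  assume *: "linear l1 \<and> linear l2 \<and> l1 \<le> p \<and> l2 \<le> p \<and> 0 < t \<and> t < 1 \<and>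
      (\<forall>v. t * l1 v + (1 - t) * l2 v \<le> face_support q v0 v)"
  then have le: "t * l1 v + (1 - t) * l2 v \<le> q v" for v
    using order_trans[OF _ face_support_below[OF sq, of v0 v]] by blast
  have l1: "l1 \<le> q"
    by (rule face_functionalD(3)[OF q, of l1 l2 t]) (use * le in auto)
  \<comment> \<open>The face condition speaks of the first functional only, so the two are exchanged
    and \<open>t\<close> becomes \<open>1 - t\<close>.\<close>
  have l2: "l2 \<le> q"
    by (rule face_functionalD(3)[OF q, of l2 l1 "1 - t"]) (use * le in \<open>auto simp: add.commute\<close>)
  have "t * l1 (- v0) + (1 - t) * l2 (- v0) \<le> - q v0"
    using * order_trans[OF _ face_support_neg[OF sq, of v0]] by blast
  then have a: "q v0 \<le> t * l1 v0 + (1 - t) * l2 v0"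
    using * by (simp add: linear_neg)
  have b: "(1 - t) * l2 v0 \<le> (1 - t) * q v0"
    using * l2 by (intro mult_left_mono) (auto simp: le_fun_def)
  have "t * q v0 \<le> t * l1 v0"
    using a b by (simp add: algebra_simps)
  then have "q v0 \<le> l1 v0"
    using * by simp
  moreover have "l1 v0 \<le> q v0" using l1 by (simp add: le_fun_def)
  ultimately have eq: "l1 v0 = q v0" by simp
  show "l1 \<le> face_support q v0"
  proof (rule le_funI, rule face_support_greatest)
    fix v and s :: real
    have "l1 (v + s *\<^sub>R v0) \<le> q (v + s *\<^sub>R v0)" using l1 by (simp add: le_fun_def)
    then show "l1 v \<le> q (v + s *\<^sub>R v0) - s * q v0"
      using * eq by (simp add: linear_add linear_scale)
  qed
qed

text \<open>In general an infimum of sublinear functions is not subadditive. Along a chain it is: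
  given \<open>q\<close> for one argument and \<open>r\<close> for the other, the smaller of the two
  serves for both.\<close>

lemma face_functional_INF_chain:
  assumes ne: "C \<noteq> {}" and C: "\<And>q. q \<in> C \<Longrightarrow> face_functional p q"
    and chain: "\<And>q r. q \<in> C \<Longrightarrow> r \<in> C \<Longrightarrow> q \<le> r \<or> r \<le> q"
    and p: "sublinear p"
  shows "face_functional p (\<lambda>v. INF q\<in>C. q v)" and "\<And>q v. q \<in> C \<Longrightarrow> (INF q\<in>C. q v) \<le> q v"
proof -
  define u where "u v = (INF q\<in>C. q v)" for v
  have bdd: "bdd_below ((\<lambda>q. q v) ` C)" for v
  proof (rule bdd_belowI2)
    fix q assume q: "q \<in> C"
    show "- p (- v) \<le> q v"
      using sublinear_neg_le[OF face_functionalD(1)[OF C[OF q]], of v]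
        face_functionalD(2)[OF C[OF q]] by (auto simp: le_fun_def dest: spec[of _ "- v"])
  qed
  have low: "u v \<le> q v" if "q \<in> C" for q v
    unfolding u_def using that bdd by (intro cINF_lower)
  then show "\<And>q v. q \<in> C \<Longrightarrow> (INF q\<in>C. q v) \<le> q v"
    by (simp add: u_def)
  have great: "c \<le> u v" if "\<And>q. q \<in> C \<Longrightarrow> c \<le> q v" for c v
    unfolding u_def using that ne by (intro cINF_greatest) auto
  have two: "u (v + w) \<le> q v + r w" if "q \<in> C" "r \<in> C" for v w q r
  proof -
    have "\<exists>s\<in>C. s \<le> q \<and> s \<le> r" using chain[OF that] that by auto
    then obtain s where s: "s \<in> C" "s \<le> q" "s \<le> r" by auto
    have "u (v + w) \<le> s (v + w)" by (rule low[OF s(1)])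
    also have "\<dots> \<le> s v + s w" by (rule sublinearD(1)[OF face_functionalD(1)[OF C[OF s(1)]]])
    also have "\<dots> \<le> q v + r w" using s by (intro add_mono) (auto simp: le_fun_def)
    finally show ?thesis .
  qed
  have "u (v + w) - q v \<le> u w" if "q \<in> C" for v w q
  proof (rule great)
    fix r assume "r \<in> C"
    then show "u (v + w) - q v \<le> r w" using two[OF that, of r v w] by simp
  qed
  then have "u (v + w) - u w \<le> u v" for v w
    by (intro great) (simp add: algebra_simps)
  then have sub: "u (v + w) \<le> u v + u w" for v w
    by (simp add: algebra_simps)
  have scale: "u (t *\<^sub>R v) \<le> t * u v" if t: "t > 0" for t v
  proof -
    have "u (t *\<^sub>R v) / t \<le> u v"
    proof (rule great)
      fix q assume q: "q \<in> C"
      have "u (t *\<^sub>R v) \<le> t * q v"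
        by (rule order_trans[OF low[OF q] sublinearD(2)[OF face_functionalD(1)[OF C[OF q]] t]])
      then show "u (t *\<^sub>R v) / t \<le> q v" using t by (simp add: field_simps)
    qed
    then show ?thesis using t by (simp add: field_simps)
  qed
  have q0: "q 0 = 0" if "q \<in> C" for q
    using sublinearD(3)[OF face_functionalD(1)[OF C[OF that]]] .
  have "u 0 = 0"
    using ne low[of _ 0] great[of 0 0] q0 by (metis antisym ex_in_conv order_refl)
  with sub scale have "sublinear u" by (simp add: sublinear_def)
  moreover have "u \<le> p"
  proof -
    obtain q where q: "q \<in> C" using ne by auto
    show ?thesis
      using order_trans[OF low[OF q] le_funD[OF face_functionalD(2)[OF C[OF q]]]] by (rule le_funI)
  qed
  moreover have "l1 \<le> u"
    if "linear l1" "linear l2" "l1 \<le> p" "l2 \<le> p" "0 < t" "t < 1"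
      "\<And>v. t * l1 v + (1 - t) * l2 v \<le> u v" for l1 l2 t
  proof (rule le_funI, rule great)
    fix v q assume q: "q \<in> C"
    have "l1 \<le> q"
      by (rule face_functionalD(3)[OF C[OF q], of l1 l2 t])
        (use that order_trans[OF that(7) low[OF q]] in auto)
    then show "l1 v \<le> q v" by (simp add: le_fun_def)
  qed
  ultimately have "face_functional p u"
    unfolding face_functional_def by blast
  then show "face_functional p (\<lambda>v. INF q\<in>C. q v)"
    by (simp add: u_def[abs_def])
qed

text \<open>For a minimal face functional \<open>l\<close>, each \<open>face_support l v\<close> is
  a candidate below \<open>l\<close>, hence equal to \<open>l\<close>, and its bound at
  \<open>- v\<close> makes \<open>l\<close> odd. For linear \<open>l\<close> the face condition
  becomes extremality.\<close>

lemma Hahn_Banach_extreme: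
  fixes p :: "'v::real_vector \<Rightarrow> real"
  assumes p: "sublinear p"
  obtains l where "linear l" "l \<le> p" "l v0 = p v0"
    "\<And>l1 l2 t. \<lbrakk>linear l1; linear l2; l1 \<le> p; l2 \<le> p; 0 < t; t < 1;
      \<And>v. t * l1 v + (1 - t) * l2 v = l v\<rbrakk> \<Longrightarrow> l1 = l"
proof -
  \<comment> \<open>The value at \<open>v0\<close> is recorded as an upper bound at
    \<open>- v0\<close>, since that is inherited by smaller functions; once \<open>l\<close> is odd
    and below \<open>p\<close> it reads \<open>l v0 = p v0\<close>.\<close>
  define A where "A = {q. face_functional p q \<and> q (- v0) \<le> - p v0}"
  have pp: "face_functional p p"
    using p by (simp add: face_functional_def)
  have start: "face_support p v0 \<in> A"
    using face_functional_face_support[OF pp] face_support_neg[OF p] by (simp add: A_def)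
  have "\<exists>m\<in>A. \<forall>a\<in>A. a \<le> m \<longrightarrow> a = m"
  proof (rule predicate_Zorn)
    \<comment> \<open>The order is reversed, so Zorn's lemma produces a pointwise minimal
      element.\<close>
    show "partial_order_on A (relation_of (\<lambda>a b. b \<le> a) A)"
      by (rule partial_order_on_relation_ofI) auto
    fix C assume C: "C \<in> Chains (relation_of (\<lambda>a b. b \<le> a) A)"
    then have CA: "C \<subseteq> A" and chain: "\<And>q r. q \<in> C \<Longrightarrow> r \<in> C \<Longrightarrow> q \<le> r \<or> r \<le> q"
      by (auto simp: Chains_def relation_of_def)
    show "\<exists>u\<in>A. \<forall>a\<in>C. u \<le> a"
    proof (cases "C = {}")
      case True
      then show ?thesis using start by auto
    next
      case False
      have f: "face_functional p q" if "q \<in> C" for q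
        using that CA by (auto simp: A_def)
      note inf = face_functional_INF_chain[OF False f chain p]
      obtain q where q: "q \<in> C" using False by auto
      then have "(INF q\<in>C. q (- v0)) \<le> q (- v0)" "q (- v0) \<le> - p v0"
        using inf(2) CA by (auto simp: A_def)
      then have "(\<lambda>v. INF q\<in>C. q v) \<in> A"
        using inf(1) by (simp add: A_def)
      then show ?thesis using inf(2) by (intro bexI) (auto simp: le_fun_def)
    qed
  qed
  then obtain l where lA: "l \<in> A" and min: "\<And>a. a \<in> A \<Longrightarrow> a \<le> l \<Longrightarrow> a = l" by auto
  have lf: "face_functional p l" and lv0: "l (- v0) \<le> - p v0" using lA by (auto simp: A_def)
  note sl = face_functionalD(1)[OF lf] and lp = face_functionalD(2)[OF lf]
  have neg: "l (- v) = - l v" for v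
  proof -
    have "face_support l v \<in> A"
      using face_functional_face_support[OF lf] face_support_below[OF sl, of v "- v0"] lv0
      by (auto simp: A_def)
    moreover have "face_support l v \<le> l"
      using face_support_below[OF sl] by (auto simp: le_fun_def)
    ultimately have "face_support l v = l" by (rule min)
    then have "l (- v) \<le> - l v" using face_support_neg[OF sl, of v] by simp
    with sublinear_neg_le[OF sl, of v] show ?thesis by simp
  qed
  have lin: "linear l" by (rule sublinear_odd_imp_linear[OF sl neg])
  have eq: "l v0 = p v0"
    using lv0 neg[of v0] lp by (auto simp: le_fun_def intro: antisym)
  have "l1 = l" if "linear l1" "linear l2" "l1 \<le> p" "l2 \<le> p" "0 < t" "t < 1"
      "\<And>v. t * l1 v + (1 - t) * l2 v = l v" for l1 l2 t
  proof -
    have le: "l1 \<le> l"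
      by (rule face_functionalD(3)[OF lf, of l1 l2 t]) (use that in auto)
    show ?thesis
    proof
      fix v
      have "l1 v \<le> l v" "l1 (- v) \<le> l (- v)" using le by (auto simp: le_fun_def)
      then show "l1 v = l v" using that(1) by (simp add: neg linear_neg)
    qed
  qed
  then show ?thesis using that[OF lin lp eq] by blast
qed

subsection \<open>Riesz representation on a compact metric space\<close>

text \<open>Multiples of the distance to the complement, cut off at 1. The value 1 is reached after
  finitely many steps, which keeps both the dominated convergence and the later covering argument
  elementary.\<close>

lemma open_indicator_approx:
  fixes U :: "'a::metric_space set"
  assumes "open U"
  obtains u :: "nat \<Rightarrow> 'a \<Rightarrow> real" where
    "\<And>n. continuous_on UNIV (u n)" "\<And>n x. 0 \<le> u n x" "\<And>n x. u n x \<le> indicator U x"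
    "\<And>x. incseq (\<lambda>n. u n x)" "\<And>x. x \<in> U \<Longrightarrow> \<forall>\<^sub>F n in sequentially. u n x = 1"
\<comment> \<open>The distance to an empty complement is 0 by convention, so the formula would fail
  for the whole space.\<close>
proof (cases "U = UNIV")
  case True
  show ?thesis
    by (rule that[of "\<lambda>_ _. 1"]) (auto simp: True incseq_def)
next
  case False
  define u where "u n x = min 1 (real n * infdist x (- U))" for n x
  show ?thesis
  proof (rule that[of u])
    show "continuous_on UNIV (u n)" for n
      unfolding u_def by (intro continuous_intros)
    show "0 \<le> u n x" for n x
      by (simp add: u_def infdist_nonneg)
    show "u n x \<le> indicator U x" for n x
      by (auto simp: u_def indicator_def)
    show "incseq (\<lambda>n. u n x)" for x
      unfolding u_def incseq_def
      by (intro allI impI min.mono mult_right_mono) (auto simp: infdist_nonneg)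
    fix x assume "x \<in> U"
    then have pos: "infdist x (- U) > 0"
      using infdist_pos_not_in_closed[of "- U" x] assms False by auto
    then obtain N where N: "1 < real N * infdist x (- U)"
      using reals_Archimedean3 by blast
    have "u n x = 1" if "n \<ge> N" for n
    proof -
      have "real N * infdist x (- U) \<le> real n * infdist x (- U)"
        using that pos by (intro mult_right_mono) auto
      then show ?thesis using N by (simp add: u_def)
    qed
    then show "\<forall>\<^sub>F n in sequentially. u n x = 1"
      by (auto simp: eventually_sequentially)
  qed
qed

text \<open>Indicators of open sets are limits of continuous functions with values in
  \<open>[0, 1]\<close>, and the open sets are an intersection-stable generator. It yields
  invariance of the representing measure and later identifies that measure with a normalised
  restriction.\<close>

lemma prob_space_eqI_integral:
  fixes M N :: "'a::metric_space measure"
  assumes M: "prob_space M" "sets M = sets borel" and N: "prob_space N" "sets N = sets borel"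
    and eq: "\<And>g. continuous_on UNIV g \<Longrightarrow> (\<And>x. \<bar>g x\<bar> \<le> 1) \<Longrightarrow>
      (\<integral>x. g x \<partial>M) = (\<integral>x. g x \<partial>N :: real)"
  shows "M = N"
proof -
  \<comment> \<open>One sequence serves all measures, so the integrals against \<open>M\<close> and
    \<open>N\<close> can be compared term by term.\<close>
  have lim: "\<exists>u. (\<forall>n. continuous_on UNIV (u n)) \<and> (\<forall>n x. \<bar>u n x\<bar> \<le> (1::real)) \<and>
      (\<forall>Q. prob_space Q \<and> sets Q = sets borel \<longrightarrow>
        (\<lambda>n. \<integral>x. u n x \<partial>Q) \<longlonglongrightarrow> measure Q U)"
    if U: "open U" for U :: "'a set"
  proof -
    obtain u :: "nat \<Rightarrow> 'a \<Rightarrow> real" where u: "\<And>n. continuous_on UNIV (u n)" "\<And>n x. 0 \<le> u n x"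
      "\<And>n x. u n x \<le> indicator U x" "\<And>x. x \<in> U \<Longrightarrow> \<forall>\<^sub>F n in sequentially. u n x = 1"
      using open_indicator_approx[OF U] by metis
    have b: "\<bar>u n x\<bar> \<le> 1" for n x
      using u(2)[of n x] order_trans[OF u(3)[of n x] indicator_le_1[of U x]] by simp
    have "(\<lambda>n. \<integral>x. u n x \<partial>Q) \<longlonglongrightarrow> measure Q U"
      if Q: "prob_space Q" "sets Q = sets borel" for Q
    proof -
      interpret prob_space Q by fact
      have "(\<lambda>n. \<integral>x. u n x \<partial>Q) \<longlonglongrightarrow> (\<integral>x. indicator U x \<partial>Q)"
      proof (rule integral_dominated_convergence[where w = "\<lambda>_. 1"])
        show "(\<lambda>x. indicator U x :: real) \<in> borel_measurable Q"
          using U Q(2) by (intro borel_measurable_indicator) auto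
        show "u n \<in> borel_measurable Q" for n
          using borel_measurable_continuous_onI[OF u(1)] Q(2) by (simp cong: measurable_cong_sets)
        show "AE x in Q. (\<lambda>n. u n x) \<longlonglongrightarrow> indicator U x"
        proof (rule AE_I2)
          fix x
          show "(\<lambda>n. u n x) \<longlonglongrightarrow> indicator U x"
          proof (cases "x \<in> U")
            case True
            then show ?thesis using u(4)[OF True] by (simp add: tendsto_eventually)
          next
            case False
            then have "u n x = 0" for n using u(2)[of n x] u(3)[of n x] by simp
            then show ?thesis using False by simp
          qed
        qed
      qed (use b in auto)
      then show ?thesis
        using U Q(2) sets_eq_imp_space_eq[OF Q(2)] by simp
    qed
    with u(1) b show ?thesis by blast
  qed
  have op: "emeasure M U = emeasure N U" if U: "open U" for U
  proof -
    obtain u where u: "\<And>n. continuous_on UNIV (u n)" "\<And>n x. \<bar>u n x\<bar> \<le> (1::real)"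
      "\<And>Q. prob_space Q \<Longrightarrow> sets Q = sets borel \<Longrightarrow>
        (\<lambda>n. \<integral>x. u n x \<partial>Q) \<longlonglongrightarrow> measure Q U"
      using lim[OF U] by blast
    have "(\<integral>x. u n x \<partial>M) = (\<integral>x. u n x \<partial>N)" for n
      using u by (intro eq)
    then have "measure M U = measure N U"
      using LIMSEQ_unique[OF u(3)[OF M]] u(3)[OF N] by simp
    then show ?thesis
      using M N by (simp add: finite_measure.emeasure_eq_measure prob_space.finite_measure)
  qed
  show ?thesis
  proof (rule measure_eqI_generator_eq[where E = "{U. open U}" and \<Omega> = UNIV and A = "\<lambda>_. UNIV"])
    show "Int_stable {U::'a set. open U}" by (auto simp: Int_stable_def)
    show "sets M = sigma_sets UNIV {U. open U}" "sets N = sigma_sets UNIV {U. open U}"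
      using M N by (auto simp: borel_def)
    show "emeasure M UNIV \<noteq> \<infinity>" 
      using M by (simp add: finite_measure.emeasure_eq_measure prob_space.finite_measure)
  qed (use op in auto)
qed

text \<open>\<open>L\<close> acts on plain functions so that truncations, sums and multiples are
  ordinary lambda terms; only its values on continuous functions are constrained.\<close>

locale normalized_positive_functional =
  fixes L :: "('a::metric_space \<Rightarrow> real) \<Rightarrow> real"
  assumes compact: "compact (UNIV :: 'a set)"
    and add: "\<And>g h. continuous_on UNIV g \<Longrightarrow> continuous_on UNIV h \<Longrightarrow> L (\<lambda>x. g x + h x) = L g + L h"
    and scale: "\<And>c g. continuous_on UNIV g \<Longrightarrow> L (\<lambda>x. c * g x) = c * L g"
    and mono: "\<And>g h. continuous_on UNIV g \<Longrightarrow> continuous_on UNIV h \<Longrightarrow> (\<And>x. g x \<le> h x) \<Longrightarrow> L g \<le> L h"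
    and one: "L (\<lambda>_. 1) = 1"
begin

lemma const: "L (\<lambda>_. c) = c"
  using scale[of "\<lambda>_. 1" c] one by simp

lemma sum:
  assumes "finite I" "\<And>i. i \<in> I \<Longrightarrow> continuous_on UNIV (g i)"
  shows "L (\<lambda>x. \<Sum>i\<in>I. g i x) = (\<Sum>i\<in>I. L (g i))"
  using assms
proof (induction I rule: finite_induct)
  case empty
  then show ?case using const[of 0] by simp
next
  case (insert i I)
  then show ?case by (simp add: add continuous_on_sum)
qed

text \<open>The pointwise bound takes the place of the usual demand that the support lie inside
  \<open>U\<close>; where a margin is required, a small \<open>e\<close> is given away
  instead.\<close>

definition subordinate :: "'a set \<Rightarrow> ('a \<Rightarrow> real) \<Rightarrow> bool" where
  "subordinate U g \<longleftrightarrow> continuous_on UNIV g \<and> (\<forall>x. 0 \<le> g x \<and> g x \<le> indicator U x)"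

definition content :: "'a set \<Rightarrow> real" where
  "content U = (SUP g\<in>Collect (subordinate U). L g)"

definition outer :: "'a set \<Rightarrow> real" where
  "outer A = (INF U\<in>{U. open U \<and> A \<subseteq> U}. content U)"

lemma subordinateI:
  "continuous_on UNIV g \<Longrightarrow> (\<And>x. 0 \<le> g x) \<Longrightarrow> (\<And>x. g x \<le> indicator U x) \<Longrightarrow> subordinate U g"
  by (simp add: subordinate_def)

lemma subordinateD:
  assumes "subordinate U g"
  shows "continuous_on UNIV g" "0 \<le> g x" "g x \<le> indicator U x" "x \<notin> U \<Longrightarrow> g x = 0" "g x \<le> 1"
proof -
  show a: "continuous_on UNIV g" "0 \<le> g x" "g x \<le> indicator U x"
    using assms by (auto simp: subordinate_def)
  show "g x = 0" if "x \<notin> U" using a(2,3) that by simp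
  show "g x \<le> 1" by (rule order_trans[OF a(3) indicator_le_1])
qed

lemma subordinate_zero: "subordinate U (\<lambda>_. 0)"
  by (simp add: subordinate_def)

lemma functional_le_one: "subordinate U g \<Longrightarrow> L g \<le> 1"
  using mono[OF subordinateD(1) continuous_on_const[of UNIV 1] subordinateD(5)] one by simp

lemma content_upper: "subordinate U g \<Longrightarrow> L g \<le> content U"
  unfolding content_def
proof (rule cSUP_upper)
  show "bdd_above (L ` Collect (subordinate U))"
    using functional_le_one by (intro bdd_aboveI2[of _ _ 1]) simp
qed simp

lemma content_least: "(\<And>g. subordinate U g \<Longrightarrow> L g \<le> c) \<Longrightarrow> content U \<le> c"
  unfolding content_def using subordinate_zero by (intro cSUP_least) auto

lemma content_nonneg: "0 \<le> content U"
  using content_upper[OF subordinate_zero] const[of 0] by simp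

lemma content_mono: "U \<subseteq> V \<Longrightarrow> content U \<le> content V"
proof (intro content_least content_upper subordinateI)
  fix g x assume "U \<subseteq> V" "subordinate U g"
  then show "g x \<le> indicator V x"
    using subordinateD(4,5)[of U g x] by (cases "x \<in> V"; cases "x \<in> U") auto
qed (auto dest: subordinateD)

text \<open>Dini's argument: finite sums of approximate indicators of the \<open>U i\<close>
  increase and at every point eventually exceed \<open>g - e\<close>, so by compactness one index
  works everywhere.\<close>

lemma content_UN_le:
  fixes U :: "nat \<Rightarrow> 'a set"
  assumes op: "\<And>i. open (U i)" and le: "\<And>n. (\<Sum>i<n. content (U i)) \<le> c"
  shows "content (\<Union>i. U i) \<le> c"
proof (rule content_least, rule field_le_epsilon)
  fix g and e :: real assume g: "subordinate (\<Union>i. U i) g" and e: "e > 0"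
  have "\<exists>u :: nat \<Rightarrow> 'a \<Rightarrow> real. (\<forall>n. continuous_on UNIV (u n)) \<and> (\<forall>n x. 0 \<le> u n x) \<and>
      (\<forall>n x. u n x \<le> indicator (U i) x) \<and> (\<forall>x. incseq (\<lambda>n. u n x)) \<and>
      (\<forall>x\<in>U i. \<forall>\<^sub>F n in sequentially. u n x = 1)" for i
    using open_indicator_approx[OF op[of i]] by metis
  then obtain u :: "nat \<Rightarrow> nat \<Rightarrow> 'a \<Rightarrow> real" where u: "\<And>i n. continuous_on UNIV (u i n)"
    "\<And>i n x. 0 \<le> u i n x" "\<And>i n x. u i n x \<le> indicator (U i) x" "\<And>i x. incseq (\<lambda>n. u i n x)"
    "\<And>i x. x \<in> U i \<Longrightarrow> \<forall>\<^sub>F n in sequentially. u i n x = 1"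
    by metis
  \<comment> \<open>A single index governs both the number of sets and the quality of the
    approximation, which makes \<open>F\<close> increasing in \<open>n\<close>.\<close>
  define F where "F n x = (\<Sum>i<n. u i n x)" for n x
  have contF: "continuous_on UNIV (F n)" for n
    unfolding F_def by (intro continuous_on_sum u)
  have incF: "F m x \<le> F n x" if "m \<le> n" for m n x
  proof -
    have "F m x \<le> (\<Sum>i<m. u i n x)"
      unfolding F_def using incseqD[OF u(4) that] by (intro sum_mono) auto
    also have "\<dots> \<le> F n x"
      unfolding F_def using that u(2) by (intro sum_mono2) auto
    finally show ?thesis .
  qed
  define W where "W n = {x. g x - e < F n x}" for n
  have "open (W n)" for n
    unfolding W_def using contF subordinateD(1)[OF g]
    by (intro open_Collect_less continuous_intros)
  moreover have "UNIV \<subseteq> (\<Union>n. W n)"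
  proof
    fix x
    show "x \<in> (\<Union>n. W n)"
    proof (cases "\<exists>i. x \<in> U i")
      case True
      then obtain i where "x \<in> U i" by auto
      then obtain n0 where "\<forall>n\<ge>n0. u i n x = 1"
        using u(5)[of x i] unfolding eventually_sequentially by blast
      \<comment> \<open>The index must also exceed \<open>i\<close>, so that \<open>U i\<close>
        already takes part in the sum.\<close>
      then have "u i (max n0 (Suc i)) x = 1" by simp
      moreover have "u i (max n0 (Suc i)) x \<le> F (max n0 (Suc i)) x"
        unfolding F_def using u(2) by (intro member_le_sum) auto
      ultimately have "x \<in> W (max n0 (Suc i))"
        unfolding W_def mem_Collect_eq using subordinateD(5)[OF g, of x] e by linarith
      then show ?thesis by auto
    next
      case False
      then have "g x = 0" using subordinateD(4)[OF g] by auto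
      then have "x \<in> W 0" using e by (simp add: W_def F_def)
      then show ?thesis by auto
    qed
  qed
  ultimately obtain I where I: "finite I" "UNIV \<subseteq> (\<Union>n\<in>I. W n)"
    using compactE_image[OF compact, of UNIV W] by auto
  define N where "N = Max (insert 0 I)"
  have "g x \<le> F N x + e" for x
  proof -
    obtain n where "n \<in> I" "x \<in> W n" using I by auto
    moreover then have "n \<le> N" using I by (simp add: N_def)
    ultimately show ?thesis using incF[of n N x] by (simp add: W_def)
  qed
  then have "L g \<le> L (\<lambda>x. F N x + e)"
    by (intro mono subordinateD(1)[OF g] continuous_intros contF)
  also have "\<dots> = (\<Sum>i<N. L (u i N)) + e"
    by (simp add: add contF const) (simp add: F_def[abs_def] sum u(1))
  also have "(\<Sum>i<N. L (u i N)) \<le> (\<Sum>i<N. content (U i))"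
    using u by (intro sum_mono content_upper subordinateI)
  also have "\<dots> \<le> c" by (rule le)
  finally show "L g \<le> c + e" by simp
qed

section \<open>The outer measure generated by open sets\<close>

lemma outer_lower: "open U \<Longrightarrow> A \<subseteq> U \<Longrightarrow> outer A \<le> content U"
  unfolding outer_def using content_nonneg
  by (intro cINF_lower bdd_belowI2[of _ 0]) auto

lemma outer_greatest: "(\<And>U. open U \<Longrightarrow> A \<subseteq> U \<Longrightarrow> c \<le> content U) \<Longrightarrow> c \<le> outer A"
  unfolding outer_def by (intro cINF_greatest) (auto intro: exI[of _ UNIV])

lemma outer_open: "open U \<Longrightarrow> outer U = content U"
  by (intro antisym outer_lower outer_greatest content_mono) auto

lemma outer_nonneg: "0 \<le> outer A"
  by (intro outer_greatest content_nonneg)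

lemma outer_mono: "A \<subseteq> B \<Longrightarrow> outer A \<le> outer B"
  by (intro outer_greatest outer_lower) auto

lemma outer_empty: "outer {} = 0"
proof -
  have "content {} \<le> 0"
  proof (rule content_least)
    fix g assume "subordinate {} g"
    then have "g = (\<lambda>_. 0)" using subordinateD(4) by auto
    then show "L g \<le> 0" using const[of 0] by simp
  qed
  then show ?thesis using outer_open[of "{}"] content_nonneg[of "{}"] by simp
qed

lemma outer_UNIV: "outer UNIV = 1"
proof -
  have "content UNIV \<le> 1"
    using functional_le_one by (rule content_least)
  moreover have "1 \<le> content UNIV"
    using content_upper[of UNIV "\<lambda>_. 1"] one by (simp add: subordinate_def)
  ultimately show ?thesis by (simp add: outer_open)
qed

lemma outer_close:
  assumes "e > 0"
  obtains U where "open U" "A \<subseteq> U" "content U < outer A + e"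
proof -
  have "\<exists>U. open U \<and> A \<subseteq> U \<and> content U < outer A + e"
  proof (rule ccontr)
    assume "\<nexists>U. open U \<and> A \<subseteq> U \<and> content U < outer A + e"
    then have "outer A + e \<le> content U" if "open U" "A \<subseteq> U" for U
      using that by (meson not_le)
    then have "outer A + e \<le> outer A" by (rule outer_greatest)
    with assms show False by simp
  qed
  then show ?thesis using that by blast
qed

lemma outer_UN_le:
  fixes A :: "nat \<Rightarrow> 'a set"
  assumes "summable (\<lambda>i. outer (A i))"
  shows "outer (\<Union>i. A i) \<le> (\<Sum>i. outer (A i))"
proof (rule field_le_epsilon)
  fix e :: real assume e: "e > 0"
  have "\<exists>U. open U \<and> A i \<subseteq> U \<and> content U < outer (A i) + e * (1/2) ^ Suc i" for i
  proof -
    have "0 < e * (1/2) ^ Suc i" using e by simp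
    then show ?thesis by (rule outer_close[of _ "A i"]) blast
  qed
  then obtain U where U: "\<And>i. open (U i)" "\<And>i. A i \<subseteq> U i"
    "\<And>i. content (U i) < outer (A i) + e * (1/2) ^ Suc i"
    by metis
  have s: "(\<lambda>i. outer (A i) + e * (1/2) ^ Suc i) sums ((\<Sum>i. outer (A i)) + e * 1)"
    using assms power_half_series by (intro sums_add sums_mult summable_sums)
  have "outer (\<Union>i. A i) \<le> content (\<Union>i. U i)"
    using U by (intro outer_lower) auto
  also have "\<dots> \<le> (\<Sum>i. outer (A i)) + e"
  proof (rule content_UN_le[OF U(1)])
    fix n
    have "(\<Sum>i<n. content (U i)) \<le> (\<Sum>i<n. outer (A i) + e * (1/2) ^ Suc i)"
      using U(3) by (intro sum_mono less_imp_le)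
    also have "\<dots> \<le> (\<Sum>i. outer (A i) + e * (1/2) ^ Suc i)"
      using s e outer_nonneg by (intro sum_le_suminf sums_summable[OF s]) auto
    also have "\<dots> = (\<Sum>i. outer (A i)) + e"
      using sums_unique[OF s] by simp
    finally show "(\<Sum>i<n. content (U i)) \<le> (\<Sum>i. outer (A i)) + e" .
  qed
  finally show "outer (\<Union>i. A i) \<le> (\<Sum>i. outer (A i)) + e" .
qed

lemma outer_Un_le: "outer (A \<union> B) \<le> outer A + outer B"
proof -
  define C where "C i = (if i = 0 then A else if i = Suc 0 then B else {})" for i :: nat
  have "(\<lambda>i. outer (C i)) sums (\<Sum>i\<in>{0, 1}. outer (C i))"
    by (rule sums_finite) (auto simp: C_def outer_empty)
  then have s: "(\<lambda>i. outer (C i)) sums (outer A + outer B)"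
    by (simp add: C_def)
  have "A \<union> B = (\<Union>i. C i)"
    by (auto simp: C_def split: if_splits)
  then show ?thesis
    using outer_UN_le[OF sums_summable[OF s]] sums_unique[OF s] by simp
qed

text \<open>Caratheodory's condition. If \<open>g\<close> is subordinate to
  \<open>V \<inter> U\<close> and \<open>h\<close> to the part \<open>W\<close> of \<open>V\<close>
  where \<open>g < e\<close>, then \<open>max 0 (g - e)\<close> and \<open>h\<close> are never
  nonzero together, so their sum is subordinate to \<open>V\<close> and
  \<open>L g + L h \<le> content V + e\<close>. Moreover \<open>W\<close> contains
  \<open>A - U\<close>, because \<open>g\<close> vanishes off \<open>U\<close>.\<close>

lemma outer_split_open:
  assumes U: "open U"
  shows "outer (A \<inter> U) + outer (A - U) = outer A"
proof (rule antisym)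
  show "outer A \<le> outer (A \<inter> U) + outer (A - U)"
    using outer_Un_le[of "A \<inter> U" "A - U"] by (simp add: Un_Diff_Int Un_commute)
  have "outer (A \<inter> U) + outer (A - U) \<le> content V" if V: "open V" "A \<subseteq> V" for V
  proof -
    have "content (V \<inter> U) \<le> content V - outer (A - U)"
    proof (rule content_least)
      fix g assume g: "subordinate (V \<inter> U) g"
      have "outer (A - U) \<le> content V - L g + e" if e: "e > 0" for e
      proof -
        define W where "W = V \<inter> {x. g x < e}"
        have "open W"
          unfolding W_def using V subordinateD(1)[OF g]
          by (intro open_Int open_Collect_less continuous_intros)
        moreover have "A - U \<subseteq> W"
          using V subordinateD(4)[OF g] e by (auto simp: W_def)
        ultimately have "outer (A - U) \<le> content W" by (rule outer_lower)
        also have "content W \<le> content V - L g + e"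
        proof (rule content_least)
          fix h assume h: "subordinate W h"
          have cont: "continuous_on UNIV (\<lambda>x. max 0 (g x - e) + h x)"
            using subordinateD(1)[OF g] subordinateD(1)[OF h] by (intro continuous_intros)
          have "L g + L h = L (\<lambda>x. g x + h x)"
            using subordinateD(1)[OF g] subordinateD(1)[OF h] by (simp add: add)
          also have "\<dots> \<le> L (\<lambda>x. (max 0 (g x - e) + h x) + e)"
            using subordinateD(1)[OF g] subordinateD(1)[OF h] cont
            by (intro mono continuous_intros) auto
          also have "\<dots> = L (\<lambda>x. max 0 (g x - e) + h x) + e"
            using cont by (simp add: add const)
          also have "L (\<lambda>x. max 0 (g x - e) + h x) \<le> content V"
          proof (intro content_upper subordinateI cont)
            fix x
            show "0 \<le> max 0 (g x - e) + h x"
              using subordinateD(2)[OF h, of x] by simp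
            show "max 0 (g x - e) + h x \<le> indicator V x"
            proof (cases "x \<in> V")
              case True
              show ?thesis
              proof (cases "g x < e")
                case True
                then show ?thesis using subordinateD(5)[OF h, of x] \<open>x \<in> V\<close> by simp
              next
                case False
                then have "h x = 0" using subordinateD(4)[OF h] by (simp add: W_def)
                then show ?thesis using subordinateD(5)[OF g, of x] \<open>x \<in> V\<close> e by simp
              qed
            next
              case False
              then have "g x = 0" "h x = 0"
                using subordinateD(4)[OF h] subordinateD(4)[OF g] by (auto simp: W_def)
              then show ?thesis using False e by simp
            qed
          qed
          finally show "L h \<le> content V - L g + e" by simp
        qed
        finally show ?thesis .
      qed
      then have "outer (A - U) \<le> content V - L g"
        by (rule field_le_epsilon)
      then show "L g \<le> content V - outer (A - U)" by simp
    qed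
    moreover have "outer (A \<inter> U) \<le> content (V \<inter> U)"
      using V U by (intro outer_lower) auto
    ultimately show ?thesis by simp
  qed
  then show "outer (A \<inter> U) + outer (A - U) \<le> outer A"
    by (rule outer_greatest)
qed

section \<open>Caratheodory extension to the Borel sets\<close>

lemma outer_measure_space_outer: "outer_measure_space (Pow UNIV) (\<lambda>A. ennreal (outer A))"
  unfolding outer_measure_space_def
proof (intro conjI)
  show "positive (Pow UNIV) (\<lambda>A. ennreal (outer A))"
    by (simp add: positive_def outer_empty)
  show "increasing (Pow UNIV) (\<lambda>A. ennreal (outer A))"
    by (auto simp: increasing_def intro!: ennreal_leI outer_mono)
  show "countably_subadditive (Pow UNIV) (\<lambda>A. ennreal (outer A))"
    unfolding countably_subadditive_def
  proof (intro allI impI)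
    fix A :: "nat \<Rightarrow> 'a set"
    show "ennreal (outer (\<Union>i. A i)) \<le> (\<Sum>i. ennreal (outer (A i)))"
    proof (cases "summable (\<lambda>i. outer (A i))")
      case True
      then show ?thesis
        using outer_UN_le[OF True] by (simp add: suminf_ennreal2 outer_nonneg ennreal_leI)
    next
      case False
      \<comment> \<open>A divergent series of nonnegative reals has sum \<open>top\<close>, which
        makes the bound trivial.\<close>
      then have "(\<Sum>i. ennreal (outer (A i))) = top"
        using summable_suminf_not_top[of "\<lambda>i. outer (A i)"] outer_nonneg by blast
      then show ?thesis by simp
    qed
  qed
qed

definition riesz_measure :: "'a measure" where
  "riesz_measure = measure_of UNIV (sets borel) (\<lambda>A. ennreal (outer A))"

lemma sets_riesz_measure: "sets riesz_measure = sets borel"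
  unfolding riesz_measure_def
  using sets.sigma_sets_eq[of "borel :: 'a measure"] by (simp add: sets_measure_of_conv)

text \<open>\<open>measure_of\<close> takes the given values only if they are countably additive.
  Open sets satisfy Caratheodory's condition, so all Borel sets lie in the sigma-algebra
  \<open>\<Lambda>\<close> on which this holds.\<close>

lemma emeasure_riesz_measure:
  assumes "A \<in> sets borel"
  shows "emeasure riesz_measure A = ennreal (outer A)"
proof -
  define \<Lambda> where "\<Lambda> = lambda_system UNIV (Pow UNIV) (\<lambda>A. ennreal (outer A))"
  have ms: "measure_space UNIV \<Lambda> (\<lambda>A. ennreal (outer A))"
    using sigma_algebra.caratheodory_lemma[OF sigma_algebra_Pow outer_measure_space_outer]
    by (simp add: \<Lambda>_def)
  then interpret \<Lambda>: sigma_algebra UNIV \<Lambda>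
    by (simp add: measure_space_def)
  have "U \<in> \<Lambda>" if "open U" for U
    using outer_split_open[OF that] unfolding \<Lambda>_def lambda_system_def
    by (auto simp: ennreal_plus[symmetric] outer_nonneg Int_commute Diff_eq simp del: ennreal_plus)
  then have sub: "sets borel \<subseteq> \<Lambda>"
    using \<Lambda>.sigma_sets_subset[of "{U. open U}"] by (auto simp: borel_def)
  show ?thesis
  proof (rule emeasure_measure_of[OF riesz_measure_def])
    show "positive (sets riesz_measure) (\<lambda>A. ennreal (outer A))"
      by (simp add: positive_def outer_empty)
    show "countably_additive (sets riesz_measure) (\<lambda>A. ennreal (outer A))"
      unfolding countably_additive_def sets_riesz_measure
    proof (intro allI impI)
      fix A :: "nat \<Rightarrow> 'a set"
      assume A: "range A \<subseteq> sets borel" "disjoint_family A" "(\<Union>i. A i) \<in> sets borel"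
      have "countably_additive \<Lambda> (\<lambda>A. ennreal (outer A))"
        using ms by (simp add: measure_space_def)
      then show "(\<Sum>i. ennreal (outer (A i))) = ennreal (outer (\<Union>i. A i))"
        unfolding countably_additive_def using A sub by blast
    qed
  qed (use assms sets_riesz_measure in auto)
qed

lemma space_riesz_measure: "space riesz_measure = UNIV"
  using sets_eq_imp_space_eq[OF sets_riesz_measure] by simp

lemma prob_space_riesz_measure: "prob_space riesz_measure"
  by (rule prob_spaceI) (simp add: space_riesz_measure emeasure_riesz_measure outer_UNIV)

sublocale riesz: prob_space riesz_measure
  by (rule prob_space_riesz_measure)

lemma measure_riesz_open: "open U \<Longrightarrow> measure riesz_measure U = content U"
  by (simp add: measure_def emeasure_riesz_measure outer_nonneg outer_open content_nonneg)

lemma continuous_imp_integrable_riesz: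
  assumes "continuous_on UNIV (g :: 'a \<Rightarrow> real)"
  shows "integrable riesz_measure g"
proof -
  obtain B where "\<And>x. norm (g x) \<le> B"
    using compact_imp_bounded[OF compact_continuous_image[OF assms compact]]
    by (auto simp: bounded_iff)
  then show ?thesis
    using borel_measurable_continuous_onI[OF assms] sets_riesz_measure
    by (intro riesz.integrable_const_bound[of _ B]) (auto cong: measurable_cong_sets)
qed

text \<open>Layer cake: \<open>n g\<close> is the sum of its truncations to the levels \<open>[k, k + 1]\<close>, and the
  truncation at level \<open>k\<close> is subordinate to the open set where \<open>k < n g\<close>.\<close>

lemma functional_le_integral_unit:
  assumes g: "continuous_on UNIV g" and g01: "\<And>x. 0 \<le> g x" "\<And>x. g x \<le> 1"
  shows "L g \<le> (\<integral>x. g x \<partial>riesz_measure)"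
proof (rule field_le_epsilon)
  fix e :: real assume "e > 0"
  then obtain n where n: "n > 0" "1 / real n < e"
    by (metis nat_approx_posE zero_less_Suc)
  define c where "c k x = min 1 (max 0 (real n * g x - real k))" for k :: nat and x
  define U where "U k = {x. real k < real n * g x}" for k :: nat
  have opU: "open (U k)" for k
    unfolding U_def using g by (intro open_Collect_less continuous_intros)
  have contc: "continuous_on UNIV (c k)" for k
    unfolding c_def using g by (intro continuous_intros)
  have subc: "subordinate (U k) (c k)" for k
  proof (intro subordinateI contc)
    fix x
    show "0 \<le> c k x" by (simp add: c_def)
    show "c k x \<le> indicator (U k) x" by (cases "x \<in> U k") (auto simp: c_def U_def)
  qed
  have trunc: "(\<Sum>k<m. min 1 (max 0 (y - real k))) = min y (real m)" if "0 \<le> y" for y :: real and m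
    using that by (induction m) auto
  \<comment> \<open>Fewer than \<open>real n * g x + 1\<close> levels lie strictly below
    \<open>real n * g x\<close>; the surplus 1 becomes the error \<open>1 / n\<close> after
    division.\<close>
  have count: "(\<Sum>k<m. indicator (U k) x) \<le> real n * g x + 1" for m x
  proof (induction m)
    case (Suc m)
    show ?case
    proof (cases "x \<in> U m")
      case True
      have "(\<Sum>k<Suc m. indicator (U k) x) \<le> (\<Sum>k<Suc m. 1::real)"
        by (intro sum_mono indicator_le_1)
      also have "\<dots> \<le> real n * g x + 1" using True by (simp add: U_def)
      finally show ?thesis .
    qed (use Suc in simp)
  qed (use g01 in simp)
  have "real n * L g = L (\<lambda>x. real n * g x)"
    by (simp add: scale g)
  \<comment> \<open>Since \<open>g \<le> 1\<close>, the first \<open>n\<close> levels exhaust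
    \<open>n g\<close>.\<close>
  also have "(\<lambda>x. real n * g x) = (\<lambda>x. \<Sum>k<n. c k x)"
    using trunc[of "real n * g _" n] g01 by (simp add: c_def min_def mult_left_le)
  also have "L \<dots> = (\<Sum>k<n. L (c k))"
    by (simp add: sum contc)
  also have "\<dots> \<le> (\<Sum>k<n. measure riesz_measure (U k))"
    using content_upper[OF subc] measure_riesz_open[OF opU] by (intro sum_mono) simp
  also have "\<dots> = (\<Sum>k<n. \<integral>x. indicator (U k) x \<partial>riesz_measure)"
    by (simp add: space_riesz_measure)
  also have "\<dots> = (\<integral>x. (\<Sum>k<n. indicator (U k) x) \<partial>riesz_measure)"
    using opU by (intro Bochner_Integration.integral_sum[symmetric] integrable_real_indicator)
      (auto simp: sets_riesz_measure less_top[symmetric])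
  also have "\<dots> \<le> (\<integral>x. real n * g x + 1 \<partial>riesz_measure)"
    using count opU g
    by (intro integral_mono continuous_imp_integrable_riesz continuous_intros
        Bochner_Integration.integrable_sum integrable_real_indicator)
      (auto simp: sets_riesz_measure less_top[symmetric])
  also have "\<dots> = real n * (\<integral>x. g x \<partial>riesz_measure) + 1"
    using continuous_imp_integrable_riesz[OF g] by (simp add: riesz.prob_space)
  finally have "L g \<le> (\<integral>x. g x \<partial>riesz_measure) + 1 / real n"
    using n by (simp add: field_simps)
  then show "L g \<le> (\<integral>x. g x \<partial>riesz_measure) + e"
    using n by simp
qed

lemma functional_le_integral:
  assumes g: "continuous_on UNIV g"
  shows "L g \<le> (\<integral>x. g x \<partial>riesz_measure)"
proof -
  obtain B where B: "\<And>x. \<bar>g x\<bar> \<le> B"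
    using compact_imp_bounded[OF compact_continuous_image[OF g compact]]
    by (auto simp: bounded_iff)
  \<comment> \<open>The affine map carrying \<open>[- C, C]\<close> to \<open>[0, 1]\<close> changes
    both sides alike, as \<open>L\<close> and the integral both fix constants; the 1 in the maximum
    keeps \<open>C\<close> positive.\<close>
  define C where "C = max 1 B"
  have C: "C > 0" "\<And>x. \<bar>g x\<bar> \<le> C" using B by (auto simp: C_def le_max_iff_disj)
  define h where "h x = (1 / (2 * C)) * g x + 1 / 2" for x
  have h01: "0 \<le> h x" "h x \<le> 1" for x
    using C(1) C(2)[of x] by (auto simp: h_def field_simps abs_le_iff)
  have conth: "continuous_on UNIV h"
    unfolding h_def using g by (intro continuous_intros)
  have "L h = L (\<lambda>x. (1 / (2 * C)) * g x) + L (\<lambda>_. 1 / 2)"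
    unfolding h_def using g by (intro add continuous_intros)
  then have "L h = (1 / (2 * C)) * L g + 1 / 2"
    by (simp only: scale[OF g] const)
  moreover have "(\<integral>x. h x \<partial>riesz_measure) = (1 / (2 * C)) * (\<integral>x. g x \<partial>riesz_measure) + 1 / 2"
    using continuous_imp_integrable_riesz[OF g] by (simp add: h_def riesz.prob_space)
  ultimately have "(1 / (2 * C)) * L g \<le> (1 / (2 * C)) * (\<integral>x. g x \<partial>riesz_measure)"
    using functional_le_integral_unit[OF conth h01] by simp
  then show ?thesis using C(1) by (simp add: field_simps)
qed

text \<open>The one-sided bound at \<open>- g\<close> is the reverse bound at
  \<open>g\<close>.\<close>

theorem integral_riesz_measure:
  assumes g: "continuous_on UNIV g"
  shows "(\<integral>x. g x \<partial>riesz_measure) = L g"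
proof (rule antisym)
  have "L (\<lambda>x. - 1 * g x) \<le> (\<integral>x. - 1 * g x \<partial>riesz_measure)"
    using g by (intro functional_le_integral continuous_intros)
  then show "(\<integral>x. g x \<partial>riesz_measure) \<le> L g"
    unfolding scale[OF g] by simp
qed (rule functional_le_integral[OF g])

end

subsection \<open>Ergodic measures with extremal integral\<close>

lemma compact_bcontfun:
  fixes g :: "'a::metric_space \<Rightarrow> real"
  assumes "compact (UNIV :: 'a set)" "continuous_on UNIV g"
  shows "apply_bcontfun (Bcontfun g) = g"
proof (rule Bcontfun_inverse)
  show "g \<in> bcontfun"
    using assms compact_imp_bounded[OF compact_continuous_image[OF assms(2,1)]]
    by (simp add: bcontfun_def)
qed

lemma continuous_on_funpow:
  fixes f :: "'a::topological_space \<Rightarrow> 'a"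
  assumes "continuous_on UNIV f"
  shows "continuous_on UNIV (f ^^ n)"
proof (induction n)
  case (Suc n)
  then show ?case
    using continuous_on_compose[of UNIV "f ^^ n" f] assms
    by (simp add: continuous_on_subset)
qed (simp add: id_def)

section \<open>Birkhoff sums over consecutive blocks\<close>

lemma birkhoff_sum_add:
  "birkhoff_sum f \<phi> (m + n) x = birkhoff_sum f \<phi> m x + birkhoff_sum f \<phi> n ((f ^^ m) x)"
proof (induction n)
  case (Suc n)
  have "(f ^^ (m + n)) x = (f ^^ n) ((f ^^ m) x)"
    by (simp add: add.commute[of m n] funpow_add)
  with Suc show ?case by (simp add: birkhoff_sum_def)
qed (simp add: birkhoff_sum_def)

text \<open>The bound is uniform in the starting point, so it applies to each of \<open>m\<close>
  consecutive blocks. Bounds known at different times can thus be compared at a common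
  multiple.\<close>

lemma birkhoff_sum_mult_le:
  assumes "\<And>x. birkhoff_sum f \<phi> n x \<le> real n * c"
  shows "birkhoff_sum f \<phi> (m * n) x \<le> real (m * n) * c"
proof (induction m arbitrary: x)
  case (Suc m)
  have "birkhoff_sum f \<phi> (Suc m * n) x
      = birkhoff_sum f \<phi> n x + birkhoff_sum f \<phi> (m * n) ((f ^^ n) x)"
    by (simp add: birkhoff_sum_add)
  also have "\<dots> \<le> real n * c + real (m * n) * c"
    using assms Suc by (intro add_mono)
  finally show ?case by (simp add: algebra_simps)
qed (simp add: birkhoff_sum_def)

lemma abs_birkhoff_sum_le:
  assumes "\<And>x. \<bar>\<phi> x\<bar> \<le> B"
  shows "\<bar>birkhoff_sum f \<phi> n x\<bar> \<le> real n * B"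
  unfolding birkhoff_sum_def using sum_bounded_above[of "{..<n}" "\<lambda>i. \<bar>\<phi> ((f ^^ i) x)\<bar>" B] assms
  by (intro order_trans[OF sum_abs]) simp

lemma abs_bcontfun_le: "\<bar>apply_bcontfun g x\<bar> \<le> norm g" for g :: "'a::topological_space \<Rightarrow>\<^sub>C real"
  using norm_bounded[of g x] by simp

text \<open>Stated through admissible bounds \<open>c\<close>, so that no maximum has to be named
  and membership is a pointwise inequality. By Fekete's lemma it is also the limit of the suprema of
  the averages.\<close>

definition upper_average :: "('a \<Rightarrow> 'a) \<Rightarrow> ('a::topological_space \<Rightarrow>\<^sub>C real) \<Rightarrow> real" where
  "upper_average f g = Inf {c. \<exists>n>0. \<forall>x. birkhoff_sum f g n x \<le> real n * c}"

lemma upper_average_set_ge: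
  assumes "n > 0" "\<forall>x. birkhoff_sum f (apply_bcontfun g) n x \<le> real n * c"
  shows "- norm g \<le> c"
proof -
  \<comment> \<open>\<open>undefined\<close> stands for an arbitrary point of the nonempty
    space.\<close>
  have "- (real n * norm g) \<le> birkhoff_sum f g n undefined"
    using abs_birkhoff_sum_le[of g "norm g" f n undefined] abs_bcontfun_le[of g] by simp
  also have "\<dots> \<le> real n * c" using assms by simp
  finally have "real n * (- norm g) \<le> real n * c" by simp
  then show ?thesis by (rule mult_left_le_imp_le) (use assms in simp)
qed

lemma upper_average_le:
  assumes "n > 0" "\<And>x. birkhoff_sum f (apply_bcontfun g) n x \<le> real n * c"
  shows "upper_average f g \<le> c"
  unfolding upper_average_def
  using assms upper_average_set_ge[of _ f g]
  by (intro cInf_lower bdd_belowI[of _ "- norm g"]) auto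

lemma upper_average_less:
  assumes "upper_average f g < c"
  obtains n where "n > 0" "\<And>x. birkhoff_sum f (apply_bcontfun g) n x \<le> real n * c"
proof -
  have "birkhoff_sum f g 1 x \<le> real 1 * norm g" for x
    using abs_birkhoff_sum_le[of g "norm g" f 1 x] abs_bcontfun_le[of g] by simp
  then have "{c. \<exists>n>0. \<forall>x. birkhoff_sum f (apply_bcontfun g) n x \<le> real n * c} \<noteq> {}"
    by blast
  from cInf_lessD[OF this] assms obtain d n where d: "d < c" "n > 0"
    "\<And>x. birkhoff_sum f (apply_bcontfun g) n x \<le> real n * d"
    unfolding upper_average_def by blast
  have "birkhoff_sum f (apply_bcontfun g) n x \<le> real n * c" for x
    using d(3)[of x] mult_left_mono[of d c "real n"] d(1) by simp
  then show ?thesis using that d(2) by blast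
qed

lemma sublinear_upper_average: "sublinear (upper_average f)"
  unfolding sublinear_def
proof (intro conjI allI impI)
  fix g h :: "'a \<Rightarrow>\<^sub>C real"
  show "upper_average f (g + h) \<le> upper_average f g + upper_average f h"
  proof (rule field_le_epsilon)
    fix e :: real assume e: "e > 0"
    obtain m where m: "m > 0" "\<And>x. birkhoff_sum f g m x \<le> real m * (upper_average f g + e / 2)"
      using upper_average_less[of f g "upper_average f g + e / 2"] e by auto
    obtain n where n: "n > 0" "\<And>x. birkhoff_sum f h n x \<le> real n * (upper_average f h + e / 2)"
      using upper_average_less[of f h "upper_average f h + e / 2"] e by auto
    show "upper_average f (g + h) \<le> upper_average f g + upper_average f h + e"
    \<comment> \<open>The bounds for \<open>g\<close> and \<open>h\<close> hold at times
      \<open>m\<close> and \<open>n\<close>; both carry over to the common multiple.\<close>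
    proof (rule upper_average_le[of "m * n"])
      fix x
      have "birkhoff_sum f (g + h) (m * n) x = birkhoff_sum f g (n * m) x + birkhoff_sum f h (m * n) x"
        by (simp add: birkhoff_sum_def sum.distrib mult.commute)
      also have "\<dots> \<le> real (n * m) * (upper_average f g + e / 2)
          + real (m * n) * (upper_average f h + e / 2)"
        using m n by (intro add_mono birkhoff_sum_mult_le)
      also have "\<dots> = real (m * n) * (upper_average f g + upper_average f h + e)"
        by (simp add: algebra_simps)
      finally show "birkhoff_sum f (g + h) (m * n) x
          \<le> real (m * n) * (upper_average f g + upper_average f h + e)" .
    qed (use m n in simp)
  qed
next
  fix t :: real and g :: "'a \<Rightarrow>\<^sub>C real" assume t: "0 < t"
  show "upper_average f (t *\<^sub>R g) \<le> t * upper_average f g"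
  proof (rule field_le_epsilon)
    fix e :: real assume e: "e > 0"
    obtain n where n: "n > 0" "\<And>x. birkhoff_sum f g n x \<le> real n * (upper_average f g + e / t)"
      using upper_average_less[of f g "upper_average f g + e / t"] e t by auto
    show "upper_average f (t *\<^sub>R g) \<le> t * upper_average f g + e"
    proof (rule upper_average_le[OF n(1)])
      fix x
      have "birkhoff_sum f (t *\<^sub>R g) n x = t * birkhoff_sum f g n x"
        by (simp add: birkhoff_sum_def sum_distrib_left)
      also have "\<dots> \<le> t * (real n * (upper_average f g + e / t))"
        using n t by (intro mult_left_mono) auto
      also have "\<dots> = real n * (t * upper_average f g + e)"
        using t by (simp add: field_simps)
      finally show "birkhoff_sum f (t *\<^sub>R g) n x \<le> real n * (t * upper_average f g + e)" .
    qed
  qed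
next
  show "upper_average f 0 = 0"
  proof (rule antisym)
    show "upper_average f 0 \<le> 0"
      by (rule upper_average_le[of 1]) (auto simp: birkhoff_sum_def)
    show "0 \<le> upper_average f 0"
    proof (rule ccontr)
      assume "\<not> 0 \<le> upper_average f 0"
      then obtain c where c: "upper_average f 0 < c" "c < 0"
        using dense[of "upper_average f 0" 0] by auto
      from upper_average_less[OF c(1)] obtain n where
        "n > 0" "\<And>x. birkhoff_sum f (0 :: 'a \<Rightarrow>\<^sub>C real) n x \<le> real n * c" by blast
      then have "- norm (0 :: 'a \<Rightarrow>\<^sub>C real) \<le> c"
        by (intro upper_average_set_ge) auto
      with c show False by simp
    qed
  qed
qed

lemma birkhoff_sum_coboundary:
  "birkhoff_sum f (\<lambda>x. h (f x) - h x) n x = h ((f ^^ n) x) - h x"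
  by (induction n) (auto simp: birkhoff_sum_def)

text \<open>The sums telescope and stay below \<open>2 * B\<close> while the time grows. Used for
  \<open>h\<close> and \<open>- h\<close>, this makes a dominated linear functional take equal
  values at \<open>h\<close> and \<open>h \<circ> f\<close>.\<close>

lemma upper_average_coboundary:
  assumes k: "\<And>x. apply_bcontfun k x = h (f x) - h x" and h: "\<And>x. \<bar>h x\<bar> \<le> B"
  shows "upper_average f k \<le> 0"
proof (rule field_le_epsilon)
  fix e :: real assume e: "e > 0"
  obtain n :: nat where n: "2 * B / e < real n" using reals_Archimedean2 by blast
  show "upper_average f k \<le> 0 + e"
  proof (rule upper_average_le)
    have "0 \<le> B" using h[of undefined] by simp
    then show "0 < n" using n e by (cases n) (auto simp: divide_simps)
    fix x
    have "apply_bcontfun k = (\<lambda>x. h (f x) - h x)" using k by auto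
    then have "birkhoff_sum f k n x = h ((f ^^ n) x) - h x"
      by (simp add: birkhoff_sum_coboundary)
    also have "\<dots> \<le> 2 * B"
      using h[of x] h[of "(f ^^ n) x"] by simp
    also have "\<dots> \<le> real n * (0 + e)"
      using n e by (simp add: field_simps)
    finally show "birkhoff_sum f k n x \<le> real n * (0 + e)" .
  qed
qed

section \<open>Integrals against invariant measures\<close>

lemma integrable_bcontfun:
  fixes g :: "'a::metric_space \<Rightarrow>\<^sub>C real"
  assumes "prob_space M" "sets M = sets borel"
  shows "integrable M g"
proof -
  interpret prob_space M by fact
  show ?thesis
    using abs_bcontfun_le[of g] borel_measurable_continuous_onI[of "apply_bcontfun g"] assms(2)
    by (intro integrable_const_bound[of _ "norm g"]) (auto cong: measurable_cong_sets)
qed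

lemma abs_integral_bcontfun_le:
  fixes g :: "'a::metric_space \<Rightarrow>\<^sub>C real"
  assumes "prob_space M" "sets M = sets borel"
  shows "\<bar>\<integral>x. g x \<partial>M\<bar> \<le> norm g"
proof -
  interpret prob_space M by fact
  have "\<bar>\<integral>x. g x \<partial>M\<bar> \<le> (\<integral>x. \<bar>g x\<bar> \<partial>M)"
    by (rule integral_abs_bound)
  also have "\<dots> \<le> (\<integral>x. norm g \<partial>M)"
    using integrable_bcontfun[OF assms] abs_bcontfun_le
    by (intro integral_mono integrable_abs) auto
  finally show ?thesis by (simp add: prob_space)
qed

lemma linear_integral_bcontfun:
  assumes "prob_space M" "sets M = sets borel"
  shows "linear (\<lambda>g :: 'a::metric_space \<Rightarrow>\<^sub>C real. \<integral>x. g x \<partial>M)"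
  by (rule linearI) (simp_all add: integrable_bcontfun[OF assms])

lemma invariant_measuresD:
  assumes "\<mu> \<in> invariant_measures f"
  shows "prob_space \<mu>" "sets \<mu> = sets borel" "space \<mu> = UNIV" "distr \<mu> borel f = \<mu>"
  using assms sets_eq_imp_space_eq[of \<mu> borel] by (auto simp: invariant_measures_def)

lemma ergodic_imp_invariant: "ergodic_measures f \<subseteq> invariant_measures f"
  by (auto simp: ergodic_measures_def)

lemma integral_invariant_funpow:
  fixes f :: "'a::metric_space \<Rightarrow> 'a" and g :: "'a \<Rightarrow>\<^sub>C real"
  assumes f: "continuous_on UNIV f" and \<mu>: "\<mu> \<in> invariant_measures f"
  shows "(\<integral>x. g ((f ^^ n) x) \<partial>\<mu>) = (\<integral>x. g x \<partial>\<mu>)"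
    and "integrable \<mu> (\<lambda>x. g ((f ^^ n) x))"
proof -
  note \<mu>D = invariant_measuresD[OF \<mu>]
  interpret prob_space \<mu> by (rule \<mu>D)
  have cont: "continuous_on UNIV (\<lambda>x. g ((f ^^ n) x))" for n
    using continuous_on_compose[OF continuous_on_funpow[OF f], of n "apply_bcontfun g"]
    by (simp add: o_def)
  show "integrable \<mu> (\<lambda>x. g ((f ^^ n) x))"
    using abs_bcontfun_le[of g] borel_measurable_continuous_onI[OF cont] \<mu>D(2)
    by (intro integrable_const_bound[of _ "norm g"]) (auto cong: measurable_cong_sets)
  show "(\<integral>x. g ((f ^^ n) x) \<partial>\<mu>) = (\<integral>x. g x \<partial>\<mu>)"
  proof (induction n)
    case (Suc n)
    have "(\<integral>x. g ((f ^^ n) x) \<partial>\<mu>) = (\<integral>x. g ((f ^^ n) x) \<partial>distr \<mu> borel f)"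
      by (simp add: \<mu>D)
    also have "\<dots> = (\<integral>x. g ((f ^^ n) (f x)) \<partial>\<mu>)"
      using borel_measurable_continuous_onI[OF f] borel_measurable_continuous_onI[OF cont] \<mu>D(2)
      by (intro integral_distr) (auto cong: measurable_cong_sets)
    finally show ?case using Suc by (simp add: funpow_swap1)
  qed simp
qed

lemma integral_birkhoff_sum:
  fixes f :: "'a::metric_space \<Rightarrow> 'a" and g :: "'a \<Rightarrow>\<^sub>C real"
  assumes f: "continuous_on UNIV f" and \<mu>: "\<mu> \<in> invariant_measures f"
  shows "(\<integral>x. birkhoff_sum f g n x \<partial>\<mu>) = real n * (\<integral>x. g x \<partial>\<mu>)"
    and "integrable \<mu> (birkhoff_sum f g n)"
  unfolding birkhoff_sum_def[abs_def]
  using integral_invariant_funpow[OF f \<mu>, of g] by auto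

lemma integral_le_upper_average:
  fixes f :: "'a::metric_space \<Rightarrow> 'a" and g :: "'a \<Rightarrow>\<^sub>C real"
  assumes f: "continuous_on UNIV f" and \<mu>: "\<mu> \<in> invariant_measures f"
  shows "(\<integral>x. g x \<partial>\<mu>) \<le> upper_average f g"
proof (rule field_le_epsilon)
  fix e :: real assume e: "e > 0"
  interpret prob_space \<mu> by (rule invariant_measuresD[OF \<mu>])
  obtain n where n: "n > 0" "\<And>x. birkhoff_sum f g n x \<le> real n * (upper_average f g + e)"
    using upper_average_less[of f g "upper_average f g + e"] e by auto
  have "real n * (\<integral>x. g x \<partial>\<mu>) = (\<integral>x. birkhoff_sum f g n x \<partial>\<mu>)"
    by (simp add: integral_birkhoff_sum[OF f \<mu>])
  also have "\<dots> \<le> (\<integral>x. real n * (upper_average f g + e) \<partial>\<mu>)"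
    using integral_birkhoff_sum(2)[OF f \<mu>, of g n] n(2) by (intro integral_mono) auto
  also have "\<dots> = real n * (upper_average f g + e)" by (simp add: prob_space)
  finally show "(\<integral>x. g x \<partial>\<mu>) \<le> upper_average f g + e" using n(1) by simp
qed

lemma integral_uniform_measure:
  fixes g :: "'a \<Rightarrow> real"
  assumes M: "prob_space M" and A: "A \<in> sets M" "measure M A \<noteq> 0" and g: "g \<in> borel_measurable M"
  shows "(\<integral>x. g x \<partial>uniform_measure M A) = (\<integral>x. indicator A x * g x \<partial>M) / measure M A"
proof -
  interpret prob_space M by fact
  have "indicator A x / emeasure M A = ennreal (indicator A x / measure M A)" for x
    using A zero_less_measure_iff[of M A] divide_ennreal[of 1 "measure M A"]
    by (auto simp: emeasure_eq_measure divide_ennreal indicator_def)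
  then have "uniform_measure M A = density M (\<lambda>x. ennreal (indicator A x / measure M A))"
    by (simp add: uniform_measure_def)
  then have "(\<integral>x. g x \<partial>uniform_measure M A) = (\<integral>x. (indicator A x / measure M A) *\<^sub>R g x \<partial>M)"
    using A g by (simp add: integral_density)
  also have "\<dots> = (\<integral>x. (indicator A x * g x) / measure M A \<partial>M)"
    by (intro Bochner_Integration.integral_cong) auto
  finally show ?thesis by simp
qed

text \<open>As \<open>A\<close> is its own preimage, the preimage of \<open>A \<inter> B\<close> is
  \<open>A\<close> intersected with the preimage of \<open>B\<close>: restricting to
  \<open>A\<close> commutes with the push-forward.\<close>

lemma uniform_measure_invariant:
  fixes f :: "'a::metric_space \<Rightarrow> 'a"
  assumes f: "continuous_on UNIV f" and \<mu>: "\<mu> \<in> invariant_measures f"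
    and A: "A \<in> sets borel" "f -` A = A" "measure \<mu> A \<noteq> 0"
  shows "uniform_measure \<mu> A \<in> invariant_measures f"
proof -
  note \<mu>D = invariant_measuresD[OF \<mu>]
  interpret prob_space \<mu> by (rule \<mu>D)
  have fm: "f \<in> measurable \<mu> borel" "f \<in> measurable (uniform_measure \<mu> A) borel"
    using borel_measurable_continuous_onI[OF f] \<mu>D(2) by (auto cong: measurable_cong_sets)
  have "prob_space (uniform_measure \<mu> A)"
    using A(3) by (intro prob_space_uniform_measure) (auto simp: emeasure_eq_measure)
  moreover have "distr (uniform_measure \<mu> A) borel f = uniform_measure \<mu> A"
  proof (rule measure_eqI)
    fix B assume "B \<in> sets (distr (uniform_measure \<mu> A) borel f)"
    then have B: "B \<in> sets borel" by simp
    have pre: "f -` B \<in> sets \<mu>"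
      using measurable_sets[OF fm(1) B] \<mu>D(3) by simp
    have "emeasure \<mu> (A \<inter> B) = emeasure (distr \<mu> borel f) (A \<inter> B)"
      by (simp add: \<mu>D)
    also have "\<dots> = emeasure \<mu> (f -` (A \<inter> B))"
      using A B fm \<mu>D(3) by (subst emeasure_distr) auto
    finally have "emeasure \<mu> (A \<inter> B) = emeasure \<mu> (A \<inter> f -` B)"
      using A(2) by (simp add: vimage_Int)
    then show "emeasure (distr (uniform_measure \<mu> A) borel f) B = emeasure (uniform_measure \<mu> A) B"
      using A B fm(2) pre \<mu>D(2,3) by (simp add: emeasure_distr space_uniform_measure)
  qed (simp add: \<mu>D(2))
  ultimately show ?thesis using \<mu>D(2) by (simp add: invariant_measures_def)
qed

lemma exists_ergodic_upper_average:
  fixes f :: "'a::metric_space \<Rightarrow> 'a" and \<phi> :: "'a \<Rightarrow>\<^sub>C real"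
  assumes X: "compact (UNIV :: 'a set)" and f: "continuous_on UNIV f"
  obtains \<mu> where "\<mu> \<in> ergodic_measures f" "(\<integral>x. \<phi> x \<partial>\<mu>) = upper_average f \<phi>"
proof -
  let ?p = "upper_average f"
  obtain l where lin: "linear l" and lp: "l \<le> ?p" and l\<phi>: "l \<phi> = ?p \<phi>"
    and extr: "\<And>l1 l2 t. \<lbrakk>linear l1; linear l2; l1 \<le> ?p; l2 \<le> ?p; 0 < t; t < 1;
      \<And>v. t * l1 v + (1 - t) * l2 v = l v\<rbrakk> \<Longrightarrow> l1 = l"
    using Hahn_Banach_extreme[OF sublinear_upper_average, of f \<phi>] by metis
  note B = compact_bcontfun[OF X]
  define L where "L g = l (Bcontfun g)" for g
  have Lb: "L (apply_bcontfun g) = l g" for g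
    by (simp add: L_def apply_bcontfun_inverse)
  \<comment> \<open>Domination at time 1. Applied to a difference it gives monotonicity, applied to
    the constants 1 and -1 the normalisation.\<close>
  have le0: "l g \<le> c" if "\<And>x. apply_bcontfun g x \<le> c" for g c
  proof -
    have "?p g \<le> c"
      by (rule upper_average_le[of 1]) (use that in \<open>auto simp: birkhoff_sum_def\<close>)
    then show ?thesis using le_funD[OF lp, of g] by simp
  qed
  interpret R: normalized_positive_functional L
  proof
    fix g h :: "'a \<Rightarrow> real" assume gh: "continuous_on UNIV g" "continuous_on UNIV h"
    have "Bcontfun (\<lambda>x. g x + h x) = Bcontfun g + Bcontfun h"
      using gh by (intro bcontfun_eqI) (simp add: B continuous_intros)
    then show "L (\<lambda>x. g x + h x) = L g + L h"
      by (simp add: L_def linear_add[OF lin])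
    assume "\<And>x. g x \<le> h x"
    then have "l (Bcontfun g - Bcontfun h) \<le> 0"
      using gh by (intro le0) (simp add: B)
    then show "L g \<le> L h" by (simp add: L_def linear_diff[OF lin])
  next
    fix c and g :: "'a \<Rightarrow> real" assume g: "continuous_on UNIV g"
    have "Bcontfun (\<lambda>x. c * g x) = c *\<^sub>R Bcontfun g"
      using g by (intro bcontfun_eqI) (simp add: B continuous_intros)
    then show "L (\<lambda>x. c * g x) = c * L g"
      by (simp add: L_def linear_scale[OF lin])
  next
    have "l (- Bcontfun (\<lambda>_. 1)) \<le> - 1" "l (Bcontfun (\<lambda>_. 1)) \<le> 1"
      by (auto intro!: le0 simp: B)
    then show "L (\<lambda>_. 1) = 1" by (simp add: L_def linear_neg[OF lin])
  qed (rule X)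
  define \<mu> where "\<mu> = R.riesz_measure"
  have sets: "sets \<mu> = sets borel" and prob: "prob_space \<mu>"
    by (simp_all add: \<mu>_def R.sets_riesz_measure R.prob_space_riesz_measure)
  interpret prob_space \<mu> by fact
  have int: "(\<integral>x. g x \<partial>\<mu>) = l g" for g :: "'a \<Rightarrow>\<^sub>C real"
    unfolding \<mu>_def by (simp add: R.integral_riesz_measure Lb)
  have fm: "f \<in> measurable \<mu> borel"
    using borel_measurable_continuous_onI[OF f] sets by (auto cong: measurable_cong_sets)
  have "distr \<mu> borel f = \<mu>"
  proof (rule prob_space_eqI_integral)
    show "prob_space (distr \<mu> borel f)" by (rule prob_space_distr[OF fm])
    fix g :: "'a \<Rightarrow> real" assume g: "continuous_on UNIV g" "\<And>x. \<bar>g x\<bar> \<le> 1"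
    have gf: "continuous_on UNIV (\<lambda>x. g (f x))"
      using continuous_on_compose[OF f, of g] g(1) by (simp add: o_def continuous_on_subset)
    \<comment> \<open>Both signs of the coboundary are bounded by 0 under \<open>?p\<close>, so
      \<open>l\<close> cannot distinguish \<open>g\<close> from \<open>g \<circ> f\<close>.\<close>
    have 1: "?p (Bcontfun (\<lambda>x. g (f x)) - Bcontfun g) \<le> 0"
      by (rule upper_average_coboundary[of _ g f 1]) (use g gf in \<open>auto simp: B\<close>)
    have 2: "?p (Bcontfun g - Bcontfun (\<lambda>x. g (f x))) \<le> 0"
      by (rule upper_average_coboundary[of _ "\<lambda>x. - g x" f 1]) (use g gf in \<open>auto simp: B\<close>)
    have "l (Bcontfun (\<lambda>x. g (f x))) = l (Bcontfun g)"
      using order_trans[OF le_funD[OF lp] 1] order_trans[OF le_funD[OF lp] 2]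
      by (simp add: linear_diff[OF lin])
    then have "(\<integral>x. g (f x) \<partial>\<mu>) = (\<integral>x. g x \<partial>\<mu>)"
      using int[of "Bcontfun (\<lambda>x. g (f x))"] int[of "Bcontfun g"] by (simp add: B g gf)
    then show "(\<integral>x. g x \<partial>distr \<mu> borel f) = (\<integral>x. g x \<partial>\<mu>)"
      using fm borel_measurable_continuous_onI[OF g(1)] by (simp add: integral_distr)
  qed (use prob sets in auto)
  then have inv: "\<mu> \<in> invariant_measures f"
    using prob sets by (simp add: invariant_measures_def)
  have "measure \<mu> A = 0 \<or> measure \<mu> A = 1" if A: "A \<in> sets borel" "f -` A = A" for A
  proof (rule ccontr)
    assume "\<not> (measure \<mu> A = 0 \<or> measure \<mu> A = 1)"
    then have t: "measure \<mu> A \<noteq> 0" "measure \<mu> A \<noteq> 1" by auto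
    then have t01: "0 < measure \<mu> A" "measure \<mu> A < 1"
      using measure_nonneg[of \<mu> A] prob_le_1[of A] by linarith+
    have space: "space \<mu> = UNIV" by (rule invariant_measuresD[OF inv])
    have compl: "measure \<mu> (- A) = 1 - measure \<mu> A"
      using prob_compl[of A] A sets space by (simp add: Compl_eq_Diff_UNIV)
    have inv1: "uniform_measure \<mu> A \<in> invariant_measures f"
      by (rule uniform_measure_invariant[OF f inv A t(1)])
    have inv2: "uniform_measure \<mu> (- A) \<in> invariant_measures f"
      using A compl t by (intro uniform_measure_invariant[OF f inv]) (auto simp: vimage_Compl)
    let ?l = "\<lambda>A (g :: 'a \<Rightarrow>\<^sub>C real). \<integral>x. apply_bcontfun g x \<partial>uniform_measure \<mu> A"
    have "?l A = l"
    proof (rule extr)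
      show "linear (?l A)"
        by (rule linear_integral_bcontfun[OF invariant_measuresD(1,2)[OF inv1]])
      show "linear (?l (- A))"
        by (rule linear_integral_bcontfun[OF invariant_measuresD(1,2)[OF inv2]])
      show "?l A \<le> ?p" "?l (- A) \<le> ?p"
        using integral_le_upper_average[OF f inv1] integral_le_upper_average[OF f inv2]
        by (auto intro!: le_funI)
      fix g :: "'a \<Rightarrow>\<^sub>C real"
      have ig: "integrable \<mu> g" by (rule integrable_bcontfun[OF prob sets])
      have "measure \<mu> A * ?l A g + (1 - measure \<mu> A) * ?l (- A) g
          = (\<integral>x. indicator A x * g x \<partial>\<mu>) + (\<integral>x. indicator (- A) x * g x \<partial>\<mu>)"
        using A sets t compl
          integral_uniform_measure[OF prob, of A "apply_bcontfun g"]
          integral_uniform_measure[OF prob, of "- A" "apply_bcontfun g"]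
          borel_measurable_integrable[OF ig]
        by simp
      also have "\<dots> = (\<integral>x. indicator A x * g x + indicator (- A) x * g x \<partial>\<mu>)"
        using A sets ig integrable_mult_indicator[OF _ ig, of A] integrable_mult_indicator[OF _ ig, of "- A"]
        by (intro Bochner_Integration.integral_add[symmetric]) auto
      also have "\<dots> = (\<integral>x. g x \<partial>\<mu>)"
        by (intro Bochner_Integration.integral_cong) (auto simp: indicator_def)
      finally show "measure \<mu> A * ?l A g + (1 - measure \<mu> A) * ?l (- A) g = l g"
        by (simp add: int)
    qed (use t01 in auto)
    then have l: "?l A g = (\<integral>x. g x \<partial>\<mu>)" for g
      by (auto simp: int dest: fun_cong)
    \<comment> \<open>Equal integrals of continuous functions make the measures equal, yet the
      restriction gives \<open>A\<close> mass 1.\<close>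
    have "uniform_measure \<mu> A = \<mu>"
    proof (rule prob_space_eqI_integral)
      show "prob_space (uniform_measure \<mu> A)" "sets (uniform_measure \<mu> A) = sets borel"
        using invariant_measuresD[OF inv1] by auto
      fix g :: "'a \<Rightarrow> real" assume "continuous_on UNIV g"
      then show "(\<integral>x. g x \<partial>uniform_measure \<mu> A) = (\<integral>x. g x \<partial>\<mu>)"
        using l[of "Bcontfun g"] by (simp add: B)
    qed (use prob sets in auto)
    then have "measure \<mu> A = measure (uniform_measure \<mu> A) A" by simp
    also have "\<dots> = 1"
      using A sets t by (subst measure_uniform_measure) (auto simp: emeasure_eq_measure)
    finally show False using t by simp
  qed
  then have "\<mu> \<in> ergodic_measures f"
    using inv by (simp add: ergodic_measures_def)
  moreover have "(\<integral>x. \<phi> x \<partial>\<mu>) = ?p \<phi>" by (simp add: int l\<phi>)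
  ultimately show ?thesis using that by blast
qed

subsection \<open>Uniform convergence, coboundaries and irregular points\<close>

lemma birkhoff_sum_uminus: "birkhoff_sum f (\<lambda>x. - \<phi> x) n x = - birkhoff_sum f \<phi> n x"
  by (simp add: birkhoff_sum_def sum_negf)

lemma birkhoff_average_uminus: "birkhoff_average f (\<lambda>x. - \<phi> x) n x = - birkhoff_average f \<phi> n x"
  by (simp add: birkhoff_average_def birkhoff_sum_uminus)

text \<open>A bound at a single time \<open>m\<close> passes to all large times: in
  \<open>n = q * m + r\<close> with \<open>r < m\<close> the remainder contributes a bounded
  amount.\<close>

lemma eventually_birkhoff_average_less:
  fixes \<phi> :: "'a::topological_space \<Rightarrow>\<^sub>C real"
  assumes "upper_average f \<phi> < c"
  shows "\<forall>\<^sub>F n in sequentially. \<forall>x. birkhoff_average f \<phi> n x < c"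
proof -
  obtain d where d: "upper_average f \<phi> < d" "d < c" using dense[OF assms] by auto
  from upper_average_less[OF d(1)] obtain m where m: "m > 0"
    "\<And>x. birkhoff_sum f \<phi> m x \<le> real m * d" by blast
  \<comment> \<open>\<open>K\<close> bounds \<open>norm \<phi> - d\<close>, the excess per remaining
    step; the absolute value keeps it nonnegative, so that \<open>r\<close> may be replaced by
    \<open>m\<close>.\<close>
  define K where "K = norm \<phi> + \<bar>d\<bar>"
  have K: "K \<ge> 0" by (simp add: K_def)
  obtain N :: nat where N: "real m * K / (c - d) < real N" using reals_Archimedean2 by blast
  have "birkhoff_average f \<phi> n x < c" if n: "n > N" for n x
  proof -
    define q r where "q = n div m" and "r = n mod m"
    have nqr: "n = q * m + r" and r: "r < m" using m by (simp_all add: q_def r_def)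
    have "birkhoff_sum f \<phi> n x
        = birkhoff_sum f \<phi> (q * m) x + birkhoff_sum f \<phi> r ((f ^^ (q * m)) x)"
      by (simp add: nqr birkhoff_sum_add)
    also have "\<dots> \<le> real (q * m) * d + real r * norm \<phi>"
      using birkhoff_sum_mult_le[of f \<phi> m d, OF m(2)]
        abs_birkhoff_sum_le[of \<phi> "norm \<phi>" f r, OF abs_bcontfun_le]
      by (intro add_mono) (auto simp: abs_le_iff)
    also have "\<dots> = real n * d + real r * (norm \<phi> - d)"
      by (simp add: nqr algebra_simps)
    also have "real r * (norm \<phi> - d) \<le> real r * K"
      by (intro mult_left_mono) (auto simp: K_def)
    also have "real r * K \<le> real m * K"
      using r K by (intro mult_right_mono) auto
    also have "real m * K < real N * (c - d)"
      using N d(2) by (simp add: field_simps)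
    also have "real N * (c - d) \<le> real n * (c - d)"
      using n d(2) by (intro mult_right_mono) auto
    finally have "birkhoff_sum f \<phi> n x < real n * c" by (simp add: algebra_simps)
    then show ?thesis using n by (simp add: birkhoff_average_def field_simps)
  qed
  then show ?thesis by (auto simp: eventually_sequentially intro!: exI[of _ "Suc N"])
qed

lemma uniform_limit_birkhoff_average:
  fixes \<phi> :: "'a::topological_space \<Rightarrow>\<^sub>C real"
  assumes "upper_average f \<phi> \<le> c" "upper_average f (- \<phi>) \<le> - c"
  shows "uniform_limit UNIV (birkhoff_average f \<phi>) (\<lambda>_. c) sequentially"
proof (rule uniform_limitI)
  fix e :: real assume e: "e > 0"
  have "\<forall>\<^sub>F n in sequentially. \<forall>x. birkhoff_average f \<phi> n x < c + e"
    using assms e by (intro eventually_birkhoff_average_less) simp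
  moreover have "\<forall>\<^sub>F n in sequentially. \<forall>x. birkhoff_average f (- \<phi>) n x < - c + e"
    using assms e by (intro eventually_birkhoff_average_less) simp
  moreover have "\<forall>\<^sub>F n in sequentially. apply_bcontfun (- \<phi>) = (\<lambda>x. - \<phi> x)"
    by auto
  ultimately show "\<forall>\<^sub>F n in sequentially. \<forall>x\<in>UNIV. dist (birkhoff_average f \<phi> n x) c < e"
  proof eventually_elim
    case (elim n)
    show ?case
    proof
      fix x
      have "birkhoff_average f \<phi> n x < c + e" "- birkhoff_average f \<phi> n x < - c + e"
        using elim(1,2)[rule_format, of x] unfolding elim(3) birkhoff_average_uminus by blast+
      then show "dist (birkhoff_average f \<phi> n x) c < e"
        by (simp add: dist_real_def abs_less_iff)
    qed
  qed
qed

lemma integral_eq_pointwise_limit: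
  fixes f :: "'a::metric_space \<Rightarrow> 'a" and \<phi> :: "'a \<Rightarrow>\<^sub>C real"
  assumes f: "continuous_on UNIV f" and \<mu>: "\<mu> \<in> invariant_measures f"
    and lim: "\<And>x. (\<lambda>n. birkhoff_average f \<phi> n x) \<longlonglongrightarrow> c"
  shows "(\<integral>x. \<phi> x \<partial>\<mu>) = c"
proof -
  interpret prob_space \<mu> by (rule invariant_measuresD[OF \<mu>])
  have "(\<lambda>n. \<integral>x. birkhoff_average f \<phi> n x \<partial>\<mu>) \<longlonglongrightarrow> (\<integral>x. c \<partial>\<mu>)"
  proof (rule integral_dominated_convergence[where w = "\<lambda>_. norm \<phi>"])
    show "birkhoff_average f \<phi> n \<in> borel_measurable \<mu>" for n
      using borel_measurable_integrable[OF integral_birkhoff_sum(2)[OF f \<mu>, of \<phi> n]]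
      by (simp add: birkhoff_average_def[abs_def])
    show "AE x in \<mu>. norm (birkhoff_average f \<phi> n x) \<le> norm \<phi>" for n
    proof (rule AE_I2)
      fix x
      have "\<bar>birkhoff_sum f \<phi> n x\<bar> \<le> real n * norm \<phi>"
        by (rule abs_birkhoff_sum_le) (rule abs_bcontfun_le)
      then show "norm (birkhoff_average f \<phi> n x) \<le> norm \<phi>"
        by (cases "n = 0") (auto simp: birkhoff_average_def abs_mult field_simps)
    qed
  qed (use lim in auto)
  \<comment> \<open>At \<open>n = 0\<close> the average is 0 by convention, hence only eventual
    equality.\<close>
  moreover have "(\<integral>x. birkhoff_average f \<phi> n x \<partial>\<mu>) = (\<integral>x. \<phi> x \<partial>\<mu>)" if "n > 0" for n
    using that by (simp add: birkhoff_average_def integral_birkhoff_sum[OF f \<mu>])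
  then have "(\<lambda>n. \<integral>x. birkhoff_average f \<phi> n x \<partial>\<mu>) \<longlonglongrightarrow> (\<integral>x. \<phi> x \<partial>\<mu>)"
    by (intro tendsto_eventually) (auto simp: eventually_sequentially intro!: exI[of _ 1])
  ultimately show ?thesis
    using LIMSEQ_unique by (fastforce simp: prob_space)
qed

text \<open>Average over \<open>k < n\<close> the identity that exhibits the difference of
  \<open>\<phi>\<close> and its \<open>k\<close>-th iterate along \<open>f\<close> as the coboundary
  of the \<open>k\<close>-th sum. The mean of these sums is the transfer function.\<close>

lemma cohomologous_average:
  fixes f :: "'a::topological_space \<Rightarrow> 'a"
  assumes "n > 0"
  shows "\<phi> x - birkhoff_average f \<phi> n x
    = (\<Sum>k<n. birkhoff_sum f \<phi> k x) / n - (\<Sum>k<n. birkhoff_sum f \<phi> k (f x)) / n"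
proof -
  have "birkhoff_sum f \<phi> k x - birkhoff_sum f \<phi> k (f x) = \<phi> x - \<phi> ((f ^^ k) x)" for k
    by (induction k) (simp_all add: birkhoff_sum_def funpow_swap1)
  then have "(\<Sum>k<n. birkhoff_sum f \<phi> k x) - (\<Sum>k<n. birkhoff_sum f \<phi> k (f x))
      = real n * \<phi> x - birkhoff_sum f \<phi> n x"
    by (simp add: sum_subtractf[symmetric]) (simp add: sum_subtractf birkhoff_sum_def)
  then show ?thesis using assms by (simp add: birkhoff_average_def field_simps)
qed

text \<open>The averages of a cohomologous function differ from \<open>c\<close> by a telescoping
  term of order \<open>1 / n\<close>. Conversely, putting \<open>c\<close> for the average in
  \<open>cohomologous_average\<close> gives a member of \<open>cob f c\<close> that misses
  \<open>\<phi>\<close> exactly by the deviation of the average from \<open>c\<close>.\<close>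

lemma closure_cob_iff:
  fixes f :: "'a::metric_space \<Rightarrow> 'a" and \<phi> :: "'a \<Rightarrow>\<^sub>C real"
  assumes X: "compact (UNIV :: 'a set)" and f: "continuous_on UNIV f"
  shows "\<phi> \<in> closure (cob f c) \<longleftrightarrow>
    uniform_limit UNIV (birkhoff_average f \<phi>) (\<lambda>_. c) sequentially"
proof
  assume cl: "\<phi> \<in> closure (cob f c)"
  show "uniform_limit UNIV (birkhoff_average f \<phi>) (\<lambda>_. c) sequentially"
  proof (rule uniform_limitI)
    fix e :: real assume e: "e > 0"
    obtain g where g: "g \<in> cob f c" "dist g \<phi> < e / 2"
      using cl e unfolding closure_approachable by (meson half_gt_zero)
    then obtain h :: "'a \<Rightarrow>\<^sub>C real" where h: "\<And>x. g x = c + h x - h (f x)"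
      by (auto simp: cob_def)
    \<comment> \<open>Half of \<open>e\<close> is spent on \<open>\<phi> - g\<close>;
      \<open>N\<close> makes the telescoping term cost less than the other half.\<close>
    obtain N :: nat where N: "2 * norm h / (e / 2) < real N" using reals_Archimedean2 by blast
    have "dist (birkhoff_average f \<phi> n x) c < e" if n: "n > N" for n x
    proof -
      have "\<bar>birkhoff_sum f (\<lambda>x. \<phi> x - g x) n x\<bar> \<le> real n * (e / 2)"
      proof (rule abs_birkhoff_sum_le)
        fix x
        show "\<bar>\<phi> x - g x\<bar> \<le> e / 2"
          using dist_bounded[of g x \<phi>] g(2) by (simp add: dist_real_def abs_minus_commute)
      qed
      moreover have "birkhoff_sum f (\<lambda>x. \<phi> x - g x) n x
          = birkhoff_sum f \<phi> n x - real n * c + birkhoff_sum f (\<lambda>x. h (f x) - h x) n x"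
        by (simp add: birkhoff_sum_def h sum_subtractf sum.distrib)
      moreover have "\<bar>birkhoff_sum f (\<lambda>x. h (f x) - h x) n x\<bar> \<le> 2 * norm h"
        unfolding birkhoff_sum_coboundary[of f h n x]
        using abs_bcontfun_le[of h x] abs_bcontfun_le[of h "(f ^^ n) x"] by linarith
      moreover have "2 * norm h < real n * (e / 2)"
      proof -
        have "2 * norm h < real N * (e / 2)" using N e by (simp add: field_simps)
        also have "\<dots> \<le> real n * (e / 2)" using n e by (intro mult_right_mono) auto
        finally show ?thesis .
      qed
      ultimately have "\<bar>birkhoff_sum f \<phi> n x - real n * c\<bar> < real n * e"
        by (simp add: abs_if split: if_splits)
      moreover have "birkhoff_sum f \<phi> n x - real n * c = real n * (birkhoff_average f \<phi> n x - c)"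
        using n by (simp add: birkhoff_average_def field_simps)
      ultimately show ?thesis
        using n by (simp add: abs_mult dist_real_def)
    qed
    then show "\<forall>\<^sub>F n in sequentially. \<forall>x\<in>UNIV. dist (birkhoff_average f \<phi> n x) c < e"
      by (auto simp: eventually_sequentially intro!: exI[of _ "Suc N"])
  qed
next
  assume lim: "uniform_limit UNIV (birkhoff_average f \<phi>) (\<lambda>_. c) sequentially"
  show "\<phi> \<in> closure (cob f c)"
    unfolding closure_approachable
  proof (intro allI impI)
    fix e :: real assume e: "e > 0"
    then have "\<forall>\<^sub>F n in sequentially. \<forall>x\<in>UNIV. dist (birkhoff_average f \<phi> n x) c < e / 2"
      using uniform_limitD[OF lim, of "e / 2"] by simp
    then obtain N where N: "\<forall>n\<ge>N. \<forall>x\<in>UNIV. dist (birkhoff_average f \<phi> n x) c < e / 2"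
      unfolding eventually_sequentially by blast
    define n where "n = Suc N"
    have n: "n > 0" "\<And>x. \<bar>birkhoff_average f \<phi> n x - c\<bar> < e / 2"
      using N by (auto simp: n_def dist_real_def)
    define h where "h x = (\<Sum>k<n. birkhoff_sum f \<phi> k x) / n" for x
    have "continuous_on UNIV (\<lambda>x. \<phi> ((f ^^ k) x))" for k
      using continuous_on_compose[OF continuous_on_funpow[OF f], of k "apply_bcontfun \<phi>"]
      by (simp add: o_def)
    then have conth: "continuous_on UNIV h"
      unfolding h_def birkhoff_sum_def using n by (intro continuous_intros) auto
    then have contk: "continuous_on UNIV (\<lambda>x. c + h x - h (f x))"
      using continuous_on_compose[OF f, of h]
      by (intro continuous_intros) (simp_all add: o_def continuous_on_subset)
    define g where "g = Bcontfun (\<lambda>x. c + h x - h (f x))"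
    have g: "g x = c + h x - h (f x)" for x
      by (simp add: g_def compact_bcontfun[OF X contk])
    have "g \<in> cob f c"
      using g compact_bcontfun[OF X conth] by (auto simp: cob_def intro!: exI[of _ "Bcontfun h"])
    moreover have "dist g \<phi> \<le> e / 2"
    proof (rule dist_bound)
      fix x
      have "g x - \<phi> x = c - birkhoff_average f \<phi> n x"
        using cohomologous_average[OF n(1), of \<phi> x f] by (simp add: g h_def)
      then show "dist (g x) (\<phi> x) \<le> e / 2"
        using n(2)[of x] by (simp add: dist_real_def abs_minus_commute)
    qed
    ultimately show "\<exists>g\<in>cob f c. dist g \<phi> < e" using e by (intro bexI[of _ g]) auto
  qed
qed

text \<open>Specification handles finitely many blocks. With a non-strict inequality the points
  shadowing one block form a closed set, and compactness passes from finite intersections to all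
  blocks.\<close>

lemma specification_infinite:
  fixes f :: "'a::metric_space \<Rightarrow> 'a"
  assumes X: "compact (UNIV :: 'a set)" and f: "continuous_on UNIV f"
    and spec: "specification_property f" and e: "e > 0"
  obtains m :: nat where "\<And>a b xs. \<lbrakk>\<And>j. a j \<le> b j; \<And>j. b j + m \<le> a (Suc j)\<rbrakk> \<Longrightarrow>
    \<exists>z. \<forall>j\<ge>1. \<forall>p\<le>b j - a j. dist ((f ^^ (p + a j)) z) ((f ^^ p) (xs j)) \<le> e"
proof -
  obtain m :: int where m: "\<And>(k::nat) (a :: nat \<Rightarrow> nat) (b :: nat \<Rightarrow> nat) (xs :: nat \<Rightarrow> 'a).
      (\<forall>j\<in>{1..k}. a j \<le> b j) \<and> (\<forall>j\<in>{1..<k}. int (a (j + 1)) - int (b j) \<ge> m) \<Longrightarrow>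
      (\<exists>x. \<forall>j\<in>{1..k}. \<forall>p\<in>{0..b j - a j}. dist ((f ^^ (p + a j)) x) ((f ^^ p) (xs j)) < e)"
    using spec e unfolding specification_property_def by metis
  have "\<exists>z. \<forall>j\<ge>1. \<forall>p\<le>b j - a j. dist ((f ^^ (p + a j)) z) ((f ^^ p) (xs j)) \<le> e"
    if ab: "\<And>j. a j \<le> b j" and gap: "\<And>j. b j + nat m \<le> a (Suc j)"
    for a b :: "nat \<Rightarrow> nat" and xs :: "nat \<Rightarrow> 'a"
  proof -
    define T where "T j = {z. \<forall>p\<le>b j - a j. dist ((f ^^ (p + a j)) z) ((f ^^ p) (xs j)) \<le> e}" for j
    have "closed {z. dist ((f ^^ n) z) y \<le> e}" for n y
      by (intro closed_Collect_le continuous_intros continuous_on_funpow[OF f])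
    then have "closed (T j)" for j
      unfolding T_def by (intro closed_Collect_all closed_Collect_imp) auto
    moreover have "UNIV \<inter> (\<Inter>j\<in>I. T j) \<noteq> {}" if "I \<subseteq> {1..}" "finite I" for I
    proof -
      define k where "k = Max (insert 0 I)"
      have Ik: "I \<subseteq> {1..k}" using that by (auto simp: k_def)
      \<comment> \<open>The integer \<open>m\<close> might be negative; a gap of
        \<open>nat m\<close> is large enough in any case.\<close>
      have "int (a (j + 1)) - int (b j) \<ge> m" for j
        using gap[of j] by (simp add: algebra_simps)
      then obtain x where "\<forall>j\<in>{1..k}. \<forall>p\<in>{0..b j - a j}. dist ((f ^^ (p + a j)) x) ((f ^^ p) (xs j)) < e"
        using m[of k a b xs] ab by blast
      then have "x \<in> T j" if "j \<in> I" for j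
        using Ik that by (force simp: T_def)
      then show ?thesis by blast
    qed
    ultimately have "UNIV \<inter> (\<Inter>j\<in>{1..}. T j) \<noteq> {}"
      using compact_imp_fip_image[OF X, of "{1..}" T] by blast
    then show ?thesis by (auto simp: T_def)
  qed
  then show ?thesis using that by blast
qed

text \<open>Each of the first \<open>a\<close> steps costs at most \<open>B\<close> in the sum along
  \<open>z\<close>, and at most \<open>B\<close> again because the average along \<open>y\<close> is
  weighted by \<open>a + L\<close> instead of \<open>L\<close>.\<close>

lemma average_block_estimate:
  fixes \<phi> :: "'a \<Rightarrow> real"
  assumes B: "\<And>x. \<bar>\<phi> x\<bar> \<le> B" and L: "L > 0"
    and close: "\<And>p. p < L \<Longrightarrow> \<bar>\<phi> ((f ^^ (p + a)) z) - \<phi> ((f ^^ p) y)\<bar> \<le> \<eta>"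
  shows "\<bar>birkhoff_average f \<phi> (a + L) z - birkhoff_average f \<phi> L y\<bar>
    \<le> 2 * B * (real a / real (a + L)) + \<eta>"
proof -
  have \<eta>: "0 \<le> \<eta>" using close[OF L] by (meson abs_ge_zero order_trans)
  have "\<bar>birkhoff_sum f \<phi> L ((f ^^ a) z) - birkhoff_sum f \<phi> L y\<bar>
      \<le> (\<Sum>p<L. \<bar>\<phi> ((f ^^ (p + a)) z) - \<phi> ((f ^^ p) y)\<bar>)"
    unfolding birkhoff_sum_def sum_subtractf[symmetric] by (simp add: funpow_add)
  also have "\<dots> \<le> real L * \<eta>"
    using sum_bounded_above[of "{..<L}" _ \<eta>] close by simp
  finally have 1: "\<bar>birkhoff_sum f \<phi> L ((f ^^ a) z) - birkhoff_sum f \<phi> L y\<bar> \<le> real L * \<eta>" .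
  have 2: "\<bar>birkhoff_sum f \<phi> a z\<bar> \<le> real a * B" by (rule abs_birkhoff_sum_le[OF B])
  have 3: "\<bar>birkhoff_average f \<phi> L y\<bar> \<le> B"
    using abs_birkhoff_sum_le[of \<phi> B f L y] B L
    by (simp add: birkhoff_average_def abs_mult field_simps)
  define n where "n = real (a + L)"
  have n: "n > 0" using L by (simp add: n_def)
  have "n * (birkhoff_average f \<phi> (a + L) z - birkhoff_average f \<phi> L y)
      = birkhoff_sum f \<phi> a z + (birkhoff_sum f \<phi> L ((f ^^ a) z) - birkhoff_sum f \<phi> L y)
        - real a * birkhoff_average f \<phi> L y"
  proof -
    have 4: "n * birkhoff_average f \<phi> (a + L) z = birkhoff_sum f \<phi> a z + birkhoff_sum f \<phi> L ((f ^^ a) z)"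
      using n unfolding birkhoff_average_def n_def[symmetric] by (simp add: birkhoff_sum_add)
    have 5: "birkhoff_sum f \<phi> L y = real L * birkhoff_average f \<phi> L y"
      using L by (simp add: birkhoff_average_def)
    show ?thesis
      unfolding right_diff_distrib 4 5 by (simp add: n_def algebra_simps)
  qed
  also have "\<bar>\<dots>\<bar> \<le> real a * B + real L * \<eta> + real a * B"
  proof -
    have "\<bar>real a * birkhoff_average f \<phi> L y\<bar> \<le> real a * B"
      using 3 by (simp add: abs_mult mult_left_mono)
    with 1 2 show ?thesis by linarith
  qed
  also have "\<dots> \<le> 2 * B * real a + n * \<eta>"
    using \<eta> by (simp add: n_def algebra_simps)
  finally have "n * \<bar>birkhoff_average f \<phi> (a + L) z - birkhoff_average f \<phi> L y\<bar>
      \<le> 2 * B * real a + n * \<eta>"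
    using n by (simp add: abs_mult)
  then have "\<bar>birkhoff_average f \<phi> (a + L) z - birkhoff_average f \<phi> L y\<bar>
      \<le> 2 * B * (real a / n) + \<eta>"
    using n by (simp add: field_simps)
  then show ?thesis by (simp only: n_def)
qed

text \<open>The point \<open>z\<close> shadows \<open>x\<close> and \<open>y\<close> alternately, along blocks so long that each of them outweighs
  everything before it.\<close>

lemma specification_irregular_point:
  fixes f :: "'a::metric_space \<Rightarrow> 'a" and \<phi> :: "'a \<Rightarrow>\<^sub>C real"
  assumes X: "compact (UNIV :: 'a set)" and f: "continuous_on UNIV f"
    and spec: "specification_property f"
    and x: "(\<lambda>n. birkhoff_average f \<phi> n x) \<longlonglongrightarrow> \<alpha>"
    and y: "(\<lambda>n. birkhoff_average f \<phi> n y) \<longlonglongrightarrow> \<beta>"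
    and "\<alpha> \<noteq> \<beta>"
  shows "irregular_set f \<phi> \<noteq> {}"
proof -
  \<comment> \<open>A limit for \<open>z\<close> would lie within \<open>\<eta>\<close> of both
    \<open>\<alpha>\<close> and \<open>\<beta>\<close>; a third of their distance makes this
    impossible.\<close>
  define \<eta> where "\<eta> = \<bar>\<alpha> - \<beta>\<bar> / 3"
  have \<eta>: "\<eta> > 0" using \<open>\<alpha> \<noteq> \<beta>\<close> by (simp add: \<eta>_def)
  have "uniformly_continuous_on UNIV (apply_bcontfun \<phi>)"
    by (intro compact_uniformly_continuous X) simp
  then obtain d where d: "d > 0" "\<And>u v. dist u v < d \<Longrightarrow> \<bar>\<phi> u - \<phi> v\<bar> < \<eta>"
    unfolding uniformly_continuous_on_def dist_real_def using \<eta> by (metis UNIV_I)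
  \<comment> \<open>\<open>d / 2\<close> turns non-strict shadowing into the strict closeness that
    uniform continuity asks for.\<close>
  obtain m :: nat where m: "\<And>a b xs. \<lbrakk>\<And>j. a j \<le> b j; \<And>j. b j + m \<le> a (Suc j)\<rbrakk> \<Longrightarrow>
      \<exists>z. \<forall>j\<ge>1. \<forall>p\<le>b j - a j. dist ((f ^^ (p + a j)) z) ((f ^^ p) (xs j)) \<le> d / 2"
    using specification_infinite[OF X f spec, of "d / 2"] d(1) by (metis half_gt_zero)
  \<comment> \<open>The length \<open>Suc j * Suc (a j)\<close> leaves the past at most the fraction
    \<open>1 / Suc j\<close> of the time at the end of block \<open>j\<close>; the inner
    \<open>Suc\<close> keeps the length positive at \<open>a 0 = 0\<close>.\<close>
  define a where "a = rec_nat 0 (\<lambda>j aj. aj + Suc j * Suc aj + m)"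
  define b where "b j = a j + Suc j * Suc (a j)" for j
  define xs where "xs j = (if even j then x else y)" for j :: nat
  have aS: "a (Suc j) = b j + m" for j by (simp add: a_def b_def)
  obtain z where z: "\<forall>j\<ge>1. \<forall>p\<le>b j - a j. dist ((f ^^ (p + a j)) z) ((f ^^ p) (xs j)) \<le> d / 2"
    using m[of a b xs] by (auto simp: aS) (auto simp: b_def)
  define L where "L j = Suc j * Suc (a j)" for j
  have Lj: "j < L j" for j by (simp add: L_def)
  have ratio: "real (a j) / real (a j + L j) \<le> 1 / real (Suc j)" for j
  proof -
    have "real (Suc j) * real (a j) \<le> real (L j)"
      unfolding L_def of_nat_mult by (intro mult_left_mono) auto
    then show ?thesis by (simp add: field_simps L_def del: of_nat_Suc)
  qed
  have block: "\<bar>birkhoff_average f \<phi> (a j + L j) z - birkhoff_average f \<phi> (L j) (xs j)\<bar>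
      \<le> 2 * norm \<phi> * (1 / real (Suc j)) + \<eta>" if "j \<ge> 1" for j
  proof -
    have "\<bar>birkhoff_average f \<phi> (a j + L j) z - birkhoff_average f \<phi> (L j) (xs j)\<bar>
        \<le> 2 * norm \<phi> * (real (a j) / real (a j + L j)) + \<eta>"
    proof (rule average_block_estimate)
      fix p assume "p < L j"
      then have "p \<le> b j - a j" by (simp add: b_def L_def)
      then have "dist ((f ^^ (p + a j)) z) ((f ^^ p) (xs j)) \<le> d / 2"
        using z that by blast
      then have "dist ((f ^^ (p + a j)) z) ((f ^^ p) (xs j)) < d"
        using d(1) by simp
      then show "\<bar>\<phi> ((f ^^ (p + a j)) z) - \<phi> ((f ^^ p) (xs j))\<bar> \<le> \<eta>"
        using d(2) by (intro less_imp_le)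
    qed (use abs_bcontfun_le Lj[of j] in auto)
    also have "\<dots> \<le> 2 * norm \<phi> * (1 / real (Suc j)) + \<eta>"
      using ratio[of j] by (intro add_right_mono mult_left_mono) auto
    finally show ?thesis .
  qed
  \<comment> \<open>\<open>s\<close> selects blocks that shadow \<open>w\<close>. The condition
    \<open>i < s i\<close> makes it tend to infinity and avoids block 0, for which no shadowing is
    asserted.\<close>
  have limit: "\<bar>\<gamma> - \<delta>\<bar> \<le> \<eta>"
    if \<gamma>: "(\<lambda>n. birkhoff_average f \<phi> n z) \<longlonglongrightarrow> \<gamma>"
      and w: "(\<lambda>n. birkhoff_average f \<phi> n w) \<longlonglongrightarrow> \<delta>"
      and s: "\<And>i. xs (s i) = w" "\<And>i. i < s i" for \<gamma> \<delta> w s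
  proof -
    have s_top: "filterlim s at_top sequentially"
      by (intro filterlim_at_top_mono[OF filterlim_ident] always_eventually allI less_imp_le s(2))
    have "filterlim (\<lambda>i. L (s i)) at_top sequentially"
      by (intro filterlim_at_top_mono[OF s_top] always_eventually allI less_imp_le Lj)
    then have 1: "(\<lambda>i. birkhoff_average f \<phi> (L (s i)) w) \<longlonglongrightarrow> \<delta>"
      by (rule filterlim_compose[OF w])
    have "filterlim (\<lambda>i. a (s i) + L (s i)) at_top sequentially"
      by (intro filterlim_at_top_mono[OF s_top] always_eventually allI trans_le_add2 less_imp_le Lj)
    then have 2: "(\<lambda>i. birkhoff_average f \<phi> (a (s i) + L (s i)) z) \<longlonglongrightarrow> \<gamma>"
      by (rule filterlim_compose[OF \<gamma>])
    have "(\<lambda>i. 1 / real (Suc (s i))) \<longlonglongrightarrow> 0"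
      using filterlim_compose[OF LIMSEQ_inverse_real_of_nat s_top] by (simp add: inverse_eq_divide)
    then have 3: "(\<lambda>i. 2 * norm \<phi> * (1 / real (Suc (s i))) + \<eta>) \<longlonglongrightarrow> 2 * norm \<phi> * 0 + \<eta>"
      by (intro tendsto_intros)
    have "\<bar>\<gamma> - \<delta>\<bar> \<le> 2 * norm \<phi> * 0 + \<eta>"
    proof (rule LIMSEQ_le)
      show "(\<lambda>i. \<bar>birkhoff_average f \<phi> (a (s i) + L (s i)) z - birkhoff_average f \<phi> (L (s i)) w\<bar>)
          \<longlonglongrightarrow> \<bar>\<gamma> - \<delta>\<bar>"
        by (intro tendsto_rabs tendsto_diff 1 2)
      have "1 \<le> s i" for i using s(2)[of i] by simp
      then show "\<exists>N. \<forall>i\<ge>N. \<bar>birkhoff_average f \<phi> (a (s i) + L (s i)) z - birkhoff_average f \<phi> (L (s i)) w\<bar>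
          \<le> 2 * norm \<phi> * (1 / real (Suc (s i))) + \<eta>"
        using block s(1) by metis
    qed (rule 3)
    then show ?thesis by simp
  qed
  have "\<not> convergent (\<lambda>n. birkhoff_average f \<phi> n z)"
  proof
    assume "convergent (\<lambda>n. birkhoff_average f \<phi> n z)"
    then obtain \<gamma> where \<gamma>: "(\<lambda>n. birkhoff_average f \<phi> n z) \<longlonglongrightarrow> \<gamma>"
      by (auto simp: convergent_def)
    have "\<bar>\<gamma> - \<alpha>\<bar> \<le> \<eta>"
      by (rule limit[OF \<gamma> x, of "\<lambda>i. 2 * Suc i"]) (auto simp: xs_def)
    moreover have "\<bar>\<gamma> - \<beta>\<bar> \<le> \<eta>"
      by (rule limit[OF \<gamma> y, of "\<lambda>i. Suc (2 * i)"]) (auto simp: xs_def)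
    ultimately have "\<bar>\<alpha> - \<beta>\<bar> \<le> 2 * \<eta>" by linarith
    then show False using \<eta> by (simp add: \<eta>_def)
  qed
  then show ?thesis by (auto simp: irregular_set_def)
qed

text \<open>The arrows proved form the cycle B, F, D, C, B, with A attached to B and E attached to
  F.\<close>

theorem lemma1p9:
  fixes f :: "'a::metric_space \<Rightarrow> 'a"
    and \<phi> :: "'a \<Rightarrow>\<^sub>C real"
  assumes "compact (UNIV :: 'a set)"
    and "continuous_on UNIV f"
    and "specification_property f"
  shows "let
      A = (irregular_set f \<phi> \<noteq> {});
      B = (\<not> (\<exists>c. \<forall>x. (\<lambda>n. birkhoff_average f \<phi> n x) \<longlonglongrightarrow> c));
      C = ((INF \<mu>\<in>invariant_measures f. \<integral>x. \<phi> x \<partial>\<mu>)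
             < (SUP \<mu>\<in>invariant_measures f. \<integral>x. \<phi> x \<partial>\<mu>));
      D = ((INF \<mu>\<in>ergodic_measures f. \<integral>x. \<phi> x \<partial>\<mu>)
             < (SUP \<mu>\<in>ergodic_measures f. \<integral>x. \<phi> x \<partial>\<mu>));
      E = (\<phi> \<notin> (\<Union>c. closure (cob f c)));
      F = (\<not> (\<exists>c. uniform_limit UNIV (birkhoff_average f \<phi>) (\<lambda>_. c) sequentially))
    in (A \<longleftrightarrow> B) \<and> (B \<longleftrightarrow> C) \<and> (C \<longleftrightarrow> D) \<and> (D \<longleftrightarrow> E) \<and> (E \<longleftrightarrow> F)"
proof -
  define A where "A = (irregular_set f \<phi> \<noteq> {})"
  define B where "B = (\<not> (\<exists>c. \<forall>x. (\<lambda>n. birkhoff_average f \<phi> n x) \<longlonglongrightarrow> c))"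
  define C where "C = ((INF \<mu>\<in>invariant_measures f. \<integral>x. \<phi> x \<partial>\<mu>)
             < (SUP \<mu>\<in>invariant_measures f. \<integral>x. \<phi> x \<partial>\<mu>))"
  define D where "D = ((INF \<mu>\<in>ergodic_measures f. \<integral>x. \<phi> x \<partial>\<mu>)
             < (SUP \<mu>\<in>ergodic_measures f. \<integral>x. \<phi> x \<partial>\<mu>))"
  define E where "E = (\<phi> \<notin> (\<Union>c. closure (cob f c)))"
  define F where "F = (\<not> (\<exists>c. uniform_limit UNIV (birkhoff_average f \<phi>) (\<lambda>_. c) sequentially))"
  note X = assms(1) and f = assms(2) and spec = assms(3)
  let ?I = "\<lambda>\<mu>. \<integral>x. apply_bcontfun \<phi> x \<partial>\<mu>"
  have abs_I: "\<bar>?I \<mu>\<bar> \<le> norm \<phi>" if "\<mu> \<in> invariant_measures f" for \<mu>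
    using invariant_measuresD[OF that] by (intro abs_integral_bcontfun_le) auto
  \<comment> \<open>Real infima and suprema obey their order laws only for bounded nonempty
    families.\<close>
  have above: "bdd_above (?I ` M)" and below: "bdd_below (?I ` M)"
    if "M \<subseteq> invariant_measures f" for M
    using abs_I that
    by (force intro!: bdd_aboveI2[of _ _ "norm \<phi>"] bdd_belowI2[of _ "- norm \<phi>"] simp: abs_le_iff)+
  obtain \<mu> where \<mu>: "\<mu> \<in> ergodic_measures f" "?I \<mu> = upper_average f \<phi>"
    using exists_ergodic_upper_average[OF X f] by metis
  \<comment> \<open>A maximiser for \<open>- \<phi>\<close> is a minimiser for
    \<open>\<phi>\<close>.\<close>
  obtain \<nu> where \<nu>: "\<nu> \<in> ergodic_measures f" "(\<integral>x. (- \<phi>) x \<partial>\<nu>) = upper_average f (- \<phi>)"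
    using exists_ergodic_upper_average[OF X f, of "- \<phi>"] by metis
  then have \<nu>I: "?I \<nu> = - upper_average f (- \<phi>)" by simp
  have E_F: "E \<longleftrightarrow> F"
    unfolding E_def F_def using closure_cob_iff[OF X f] by auto
  have B_F: "B \<Longrightarrow> F"
    unfolding B_def F_def
    using tendsto_uniform_limitI[where S = UNIV and f = "birkhoff_average f \<phi>"] by force
  have C_B: "C \<Longrightarrow> B"
  proof (rule ccontr)
    assume C "\<not> B"
    then obtain c where "\<And>x. (\<lambda>n. birkhoff_average f \<phi> n x) \<longlonglongrightarrow> c"
      unfolding B_def by blast
    then have "?I \<mu> = c" if "\<mu> \<in> invariant_measures f" for \<mu>
      using integral_eq_pointwise_limit[OF f that] by blast
    moreover have "invariant_measures f \<noteq> {}" using \<mu> ergodic_imp_invariant by blast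
    ultimately have "(INF \<mu>\<in>invariant_measures f. ?I \<mu>) = c" "(SUP \<mu>\<in>invariant_measures f. ?I \<mu>) = c"
      by (simp_all cong: INF_cong SUP_cong)
    with \<open>C\<close> show False by (simp add: C_def)
  qed
  have D_C: "D \<Longrightarrow> C"
  proof -
    assume D
    have "(INF \<mu>\<in>invariant_measures f. ?I \<mu>) \<le> (INF \<mu>\<in>ergodic_measures f. ?I \<mu>)"
      using \<mu> ergodic_imp_invariant[of f] below by (intro cINF_superset_mono) auto
    also have "\<dots> < (SUP \<mu>\<in>ergodic_measures f. ?I \<mu>)"
      using \<open>D\<close> by (simp add: D_def)
    also have "\<dots> \<le> (SUP \<mu>\<in>invariant_measures f. ?I \<mu>)"
      using \<mu> ergodic_imp_invariant[of f] above by (intro cSUP_subset_mono) auto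
    finally show C by (simp add: C_def)
  qed
  have F_D: "F \<Longrightarrow> D"
  proof (rule ccontr)
    assume F "\<not> D"
    \<comment> \<open>Without D the supremum is at most the infimum, which squeezes the two extremal
      averages together.\<close>
    have "?I \<mu> \<le> (SUP \<mu>\<in>ergodic_measures f. ?I \<mu>)"
      using \<mu> ergodic_imp_invariant[of f] above by (intro cSUP_upper)
    also have "\<dots> \<le> (INF \<mu>\<in>ergodic_measures f. ?I \<mu>)"
      using \<open>\<not> D\<close> by (simp add: D_def)
    also have "\<dots> \<le> ?I \<nu>"
      using \<nu> ergodic_imp_invariant[of f] below by (intro cINF_lower)
    finally have "upper_average f (- \<phi>) \<le> - upper_average f \<phi>"
      by (simp add: \<mu> \<nu>I)
    then have "uniform_limit UNIV (birkhoff_average f \<phi>) (\<lambda>_. upper_average f \<phi>) sequentially"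
      by (intro uniform_limit_birkhoff_average) auto
    with \<open>F\<close> show False by (auto simp: F_def)
  qed
  have A_B: "A \<Longrightarrow> B"
    unfolding A_def B_def irregular_set_def by (auto intro: convergentI)
  have B_A: "B \<Longrightarrow> A"
  proof (rule ccontr)
    assume B "\<not> A"
    then have "\<exists>c. (\<lambda>n. birkhoff_average f \<phi> n x) \<longlonglongrightarrow> c" for x
      by (auto simp: A_def irregular_set_def convergent_def)
    then obtain l where l: "\<And>x. (\<lambda>n. birkhoff_average f \<phi> n x) \<longlonglongrightarrow> l x" by metis
    \<comment> \<open>Two different limits would produce an irregular point.\<close>
    have "l x = l y" for x y
      using specification_irregular_point[OF X f spec l l] \<open>\<not> A\<close> by (auto simp: A_def)
    then have "(\<lambda>n. birkhoff_average f \<phi> n x) \<longlonglongrightarrow> l undefined" for x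
      using l by metis
    with \<open>B\<close> show False by (auto simp: B_def)
  qed
  have "(A \<longleftrightarrow> B) \<and> (B \<longleftrightarrow> C) \<and> (C \<longleftrightarrow> D) \<and> (D \<longleftrightarrow> E) \<and> (E \<longleftrightarrow> F)"
    using E_F B_F C_B D_C F_D A_B B_A by blast
  then show ?thesis
    unfolding Let_def A_def B_def C_def D_def E_def F_def .
qed

end
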